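(* Let $X=(X_t)_{t\ge 0}$ be a one-dimensional time-homogeneous diffusion process starting from zero which is a (weak) solution of $dX_t=b(X_t)\,dt+\sigma(X_t)\,dB_t$, $X_0=0$, where $b:\mathbb{R}\to\mathbb{R}$ is Borel measurable, $\sigma:\mathbb{R}\to[0,\infty)$ is locally bounded, and $B$ is a standard Brownian motion on a filtered probability space $(\Omega,\mathcal{F},\{\mathcal{F}_t\},\mathbb{P})$ satisfying the usual conditions. Let $X^*_t=\sup_{0\le s\le t}|X_s|$. Let $g:\mathbb{R}_+\to\mathbb{R}_+$ be a strictly increasing continuous function with $g(0)=0$. Suppose that $X$ is controllable and that there exist constants $p>0$ and $C_p>0$ such that for every (deterministic) $t\ge 0$, $$\mathbb{E}(X^*_t)^p\le C_p\,(g(t))^p.$$ Then for every moderate function $F$ there exists a constant $C_F>0$ such that for every stopping time $\tau$ with respect to $\{\mathcal{F}_t\}$, $$\mathbb{E}F(X^*_\tau)\le C_F\,\mathbb{E}F(g(\tau)).$$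
   Context: $\mathbb{R}_+=[0,\infty)$. A function $F:\mathbb{R}_+\to\mathbb{R}_+$ is called moderate if (a) it is continuous, increasing (in the weak sense) and $F(0)=0$, and (b) there exists $\beta>1$ such that $\sup_{x>0}F(\beta x)/F(x)<\infty$, with the conventions $0/0=1$ and $x/0=\infty$ for $x>0$. $X$ is a time-homogeneous diffusion, so it has continuous paths and is a time-homogeneous strong Markov process with respect to $\{\mathcal{F}_t\}$; $\mathbb{P}_x(\cdot)=\mathbb{P}(\cdot\mid X_0=x)$ denotes the law of the diffusion (same coefficients $b,\sigma$) started from $x$, and $\mathbb{E}$ is expectation for the process started from $0$. $X$ is called controllable if there exist constants $\gamma,C>0$ and $\beta>1$ such that for all $t\ge 0$ and $\lambda>0$, $$\sup_{|x|=\lambda}\mathbb{P}_x(X^*_t\ge\beta\lambda)\le C\,\mathbb{P}_0(X^*_t\ge\gamma\lambda).$$ *)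

theory Defs
  imports "HOL-Probability.Probability"
begin

text \<open>
  A filtration \<open>(F t)\<close> is indexed by \<open>ennreal\<close> (and a stopping time is \<open>ennreal\<close>-valued), so that
  stopping times may take the value \<open>\<infinity>\<close> and the library notions \<^const>\<open>filtration\<close>,
  \<^const>\<open>stopping_time\<close> and \<^const>\<open>filtration.pre_sigma\<close> apply. The \<open>\<sigma>\<close>-algebra \<open>F \<infinity>\<close> is any
  one containing all \<open>F t\<close>, \<open>t < \<infinity>\<close>, and contained in that of \<open>M\<close>.
  Processes are functions of a real time, of which only times \<open>\<ge> 0\<close> matter.
\<close>

definition usual_conditions :: "'a measure \<Rightarrow> (ennreal \<Rightarrow> 'a measure) \<Rightarrow> bool" where
  "usual_conditions M F \<longleftrightarrow>
     prob_space M \<and> complete_measure M \<and>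
     filtration (space M) F \<and> (\<forall>t. subalgebra M (F t)) \<and>
     null_sets M \<subseteq> sets (F 0) \<and>
     (\<forall>t<\<infinity>. sets (F t) = (\<Inter>u\<in>{t<..}. sets (F u)))"

definition adapted :: "(ennreal \<Rightarrow> 'a measure) \<Rightarrow> (real \<Rightarrow> 'a \<Rightarrow> real) \<Rightarrow> bool" where
  "adapted F X \<longleftrightarrow> (\<forall>t\<ge>0. X t \<in> borel_measurable (F (ennreal t)))"

definition progressive :: "(ennreal \<Rightarrow> 'a measure) \<Rightarrow> (real \<Rightarrow> 'a \<Rightarrow> real) \<Rightarrow> bool" where
  "progressive F H \<longleftrightarrow>
     (\<forall>t\<ge>0. (\<lambda>(s, \<omega>). H s \<omega>) \<in>
        borel_measurable (restrict_space borel {0..t} \<Otimes>\<^sub>M F (ennreal t)))"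

definition brownian_motion ::
    "'a measure \<Rightarrow> (ennreal \<Rightarrow> 'a measure) \<Rightarrow> (real \<Rightarrow> 'a \<Rightarrow> real) \<Rightarrow> bool" where
  "brownian_motion M F B \<longleftrightarrow>
     adapted F B \<and>
     (AE \<omega> in M. B 0 \<omega> = 0) \<and>
     (AE \<omega> in M. continuous_on {0..} (\<lambda>t. B t \<omega>)) \<and>
     (\<forall>s t. 0 \<le> s \<longrightarrow> s < t \<longrightarrow>
        distributed M lborel (\<lambda>\<omega>. B t \<omega> - B s \<omega>)
          (\<lambda>x. ennreal (normal_density 0 (sqrt (t - s)) x)) \<and>
        prob_space.indep_set M (sets (F (ennreal s)))
          (sets (vimage_algebra (space M) (\<lambda>\<omega>. B t \<omega> - B s \<omega>) borel)))"


text \<open>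
  A simple process is given by times \<open>s 0 < \<dots> < s k\<close> and bounded coefficients \<open>\<xi> i\<close>, measurable
  with respect to \<open>F (s i)\<close>; its value at time \<open>u\<close> is the sum of the \<open>\<xi> i\<close> over those \<open>i\<close> with
  \<open>s i < u \<le> s (i + 1)\<close>.
\<close>

definition simple_data ::
    "(ennreal \<Rightarrow> 'a measure) \<Rightarrow> nat \<Rightarrow> (nat \<Rightarrow> real) \<Rightarrow> (nat \<Rightarrow> 'a \<Rightarrow> real) \<Rightarrow> bool" where
  "simple_data F k s \<xi> \<longleftrightarrow>
     0 \<le> s 0 \<and>
     (\<forall>i<k. s i < s (Suc i) \<and>
        \<xi> i \<in> borel_measurable (F (ennreal (s i))) \<and>
        bounded (\<xi> i ` space (F (ennreal (s i)))))"

definition simple_process ::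
    "nat \<Rightarrow> (nat \<Rightarrow> real) \<Rightarrow> (nat \<Rightarrow> 'a \<Rightarrow> real) \<Rightarrow> real \<Rightarrow> 'a \<Rightarrow> real" where
  "simple_process k s \<xi> u \<omega> = (\<Sum>i<k. \<xi> i \<omega> * indicator {s i<..s (Suc i)} u)"

definition simple_integral ::
    "(real \<Rightarrow> 'a \<Rightarrow> real) \<Rightarrow> nat \<Rightarrow> (nat \<Rightarrow> real) \<Rightarrow> (nat \<Rightarrow> 'a \<Rightarrow> real) \<Rightarrow> real \<Rightarrow> 'a \<Rightarrow> real" where
  "simple_integral B k s \<xi> t \<omega> =
     (\<Sum>i<k. \<xi> i \<omega> * (B (min (s (Suc i)) t) \<omega> - B (min (s i) t) \<omega>))"

definition null_in_probability :: "'a measure \<Rightarrow> (nat \<Rightarrow> 'a \<Rightarrow> ennreal) \<Rightarrow> bool" where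
  "null_in_probability M Z \<longleftrightarrow>
     (\<forall>\<epsilon>>0. (\<lambda>n. measure M {\<omega>\<in>space M. ennreal \<epsilon> < Z n \<omega>}) \<longlonglongrightarrow> 0)"

text \<open>
  \<open>is_ito_integral M F B H I\<close> says that \<open>I\<close> is (a continuous version of) the stochastic integral
  process of \<open>H\<close> with respect to \<open>B\<close>: the limit in probability of the integrals of simple processes
  which converge to \<open>H\<close> in \<open>L\<^sup>2([0,t])\<close> in probability for each \<open>t\<close>.
  This determines \<open>I\<close> up to indistinguishability.
\<close>

definition is_ito_integral ::
    "'a measure \<Rightarrow> (ennreal \<Rightarrow> 'a measure) \<Rightarrow> (real \<Rightarrow> 'a \<Rightarrow> real) \<Rightarrow>
     (real \<Rightarrow> 'a \<Rightarrow> real) \<Rightarrow> (real \<Rightarrow> 'a \<Rightarrow> real) \<Rightarrow> bool" where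
  "is_ito_integral M F B H I \<longleftrightarrow>
     progressive F H \<and>
     (AE \<omega> in M. \<forall>t\<ge>0. set_integrable lborel {0..t} (\<lambda>s. (H s \<omega>)\<^sup>2)) \<and>
     adapted F I \<and>
     (AE \<omega> in M. continuous_on {0..} (\<lambda>t. I t \<omega>)) \<and>
     (\<exists>k s \<xi>. (\<forall>n. simple_data F (k n) (s n) (\<xi> n)) \<and>
        (\<forall>t\<ge>0.
           null_in_probability M (\<lambda>n \<omega>. \<integral>\<^sup>+u\<in>{0..t}.
             ennreal ((simple_process (k n) (s n) (\<xi> n) u \<omega> - H u \<omega>)\<^sup>2) \<partial>lborel) \<and>
           null_in_probability M (\<lambda>n \<omega>.
             ennreal \<bar>simple_integral B (k n) (s n) (\<xi> n) t \<omega> - I t \<omega>\<bar>)))"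

definition weak_solution ::
    "(real \<Rightarrow> real) \<Rightarrow> (real \<Rightarrow> real) \<Rightarrow> 'a measure \<Rightarrow> (ennreal \<Rightarrow> 'a measure) \<Rightarrow>
     (real \<Rightarrow> 'a \<Rightarrow> real) \<Rightarrow> real \<Rightarrow> (real \<Rightarrow> 'a \<Rightarrow> real) \<Rightarrow> bool" where
  "weak_solution b \<sigma> M F B x X \<longleftrightarrow>
     usual_conditions M F \<and> brownian_motion M F B \<and>
     adapted F X \<and> (\<forall>\<omega>\<in>space M. continuous_on {0..} (\<lambda>t. X t \<omega>)) \<and>
     (AE \<omega> in M. X 0 \<omega> = x) \<and>
     (AE \<omega> in M. \<forall>t\<ge>0. set_integrable lborel {0..t} (\<lambda>s. b (X s \<omega>))) \<and>
     (\<exists>I. is_ito_integral M F B (\<lambda>s \<omega>. \<sigma> (X s \<omega>)) I \<and>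
        (AE \<omega> in M. \<forall>t\<ge>0. X t \<omega> = x + (LINT s:{0..t}|lborel. b (X s \<omega>)) + I t \<omega>))"


text \<open>
  Paths are functions on \<open>real\<close>, continuous on \<open>[0,\<infinity>)\<close>, with the \<open>\<sigma>\<close>-algebra generated by the
  evaluations at times \<open>\<ge> 0\<close> (values at negative times are invisible to it).
\<close>

definition path_space :: "(real \<Rightarrow> real) measure" where
  "path_space = sigma {w. continuous_on {0..} w}
     {{w. continuous_on {0..} w \<and> w t \<in> A} |t A. 0 \<le> t \<and> A \<in> sets borel}"

text \<open>
  The strong Markov property at a stopping time \<open>\<tau>\<close>, on the event \<open>\<tau> < \<infinity>\<close>: given the
  \<open>\<sigma>\<close>-algebra of \<open>\<tau>\<close>, the path \<open>s \<mapsto> X (\<tau> + s)\<close> has the law \<open>P (X \<tau>)\<close>. (The value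
  \<open>enn2real \<infinity> = 0\<close> is irrelevant, since \<open>\<tau> < \<infinity>\<close> is an event of that \<open>\<sigma>\<close>-algebra.)
\<close>

definition strong_markov ::
    "(real \<Rightarrow> (real \<Rightarrow> real) measure) \<Rightarrow> 'a measure \<Rightarrow> (ennreal \<Rightarrow> 'a measure) \<Rightarrow>
     (real \<Rightarrow> 'a \<Rightarrow> real) \<Rightarrow> bool" where
  "strong_markov P M F X \<longleftrightarrow>
     P \<in> borel \<rightarrow>\<^sub>M prob_algebra path_space \<and>
     (\<forall>\<tau>. stopping_time F \<tau> \<longrightarrow> (\<forall>A\<in>sets path_space.
        AE \<omega> in M. \<tau> \<omega> < \<infinity> \<longrightarrow>
          real_cond_exp M (filtration.pre_sigma (space M) F \<tau>)
            (\<lambda>\<omega>. indicator A (\<lambda>s. X (enn2real (\<tau> \<omega>) + s) \<omega>)) \<omega>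
          = measure (P (X (enn2real (\<tau> \<omega>)) \<omega>)) A))"

text \<open>
  A diffusion started from \<open>x\<close> with coefficients \<open>b\<close>, \<open>\<sigma>\<close>; here \<open>P y\<close> plays the role of the law
  of the diffusion started from \<open>y\<close>.
\<close>

definition diffusion ::
    "(real \<Rightarrow> real) \<Rightarrow> (real \<Rightarrow> real) \<Rightarrow> (real \<Rightarrow> (real \<Rightarrow> real) measure) \<Rightarrow>
     'a measure \<Rightarrow> (ennreal \<Rightarrow> 'a measure) \<Rightarrow> (real \<Rightarrow> 'a \<Rightarrow> real) \<Rightarrow> real \<Rightarrow>
     (real \<Rightarrow> 'a \<Rightarrow> real) \<Rightarrow> bool" where
  "diffusion b \<sigma> P M F B x X \<longleftrightarrow>
     weak_solution b \<sigma> M F B x X \<and>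
     distr M path_space (\<lambda>\<omega> t. X t \<omega>) = P x \<and>
     strong_markov P M F X"


text \<open>The running maximum of \<open>|w|\<close> up to time \<open>t\<close>, over all times \<open>\<ge> 0\<close> if \<open>t = \<infinity>\<close>.\<close>

definition running_max :: "(real \<Rightarrow> real) \<Rightarrow> ennreal \<Rightarrow> ennreal" where
  "running_max w t = (SUP s\<in>{s. 0 \<le> s \<and> ennreal s \<le> t}. ennreal \<bar>w s\<bar>)"

definition controllable :: "(real \<Rightarrow> (real \<Rightarrow> real) measure) \<Rightarrow> bool" where
  "controllable P \<longleftrightarrow> (\<exists>\<gamma>>0. \<exists>C>0. \<exists>\<beta>>1. \<forall>t\<ge>0. \<forall>l>0.
     (SUP x\<in>{x. \<bar>x\<bar> = l}.
        measure (P x) {w\<in>space path_space. ennreal (\<beta> * l) \<le> running_max w (ennreal t)})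
     \<le> C * measure (P 0) {w\<in>space path_space. ennreal (\<gamma> * l) \<le> running_max w (ennreal t)})"

text \<open>Division of nonnegative numbers with \<open>0/0 = 1\<close> and \<open>x/0 = \<infinity>\<close> for \<open>x > 0\<close>.\<close>

definition ratio :: "real \<Rightarrow> real \<Rightarrow> ennreal" where
  "ratio a b = (if b = 0 then (if a = 0 then 1 else \<infinity>) else ennreal (a / b))"

definition moderate :: "(real \<Rightarrow> real) \<Rightarrow> bool" where
  "moderate F \<longleftrightarrow>
     continuous_on {0..} F \<and> mono_on {0..} F \<and> F 0 = 0 \<and>
     (\<exists>\<beta>>1. (SUP x\<in>{0<..}. ratio (F (\<beta> * x)) (F x)) < \<infinity>)"

text \<open>
  The extension of an increasing \<open>f : [0,\<infinity>) \<rightarrow> [0,\<infinity>)\<close> to \<open>[0,\<infinity>]\<close> by its limit at \<open>\<infinity>\<close>.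
\<close>

definition mono_extension :: "(real \<Rightarrow> real) \<Rightarrow> ennreal \<Rightarrow> ennreal" where
  "mono_extension f x = (if x = \<infinity> then (SUP y\<in>{0..}. ennreal (f y)) else ennreal (f (enn2real x)))"

end

theory Submission
  imports Defs
begin

text \<open>
  The theorem rests on a good-\<open>\<lambda>\<close> inequality. Write \<open>X*\<close> for the running maximum of \<open>|X|\<close>. For every
  \<open>\<epsilon> > 0\<close> there is a \<open>\<delta> > 0\<close> such that for all levels \<open>l > 0\<close> and all bounded stopping times \<open>\<tau>\<close>
  \<open>P(X*_\<tau> \<ge> \<beta> l and g(\<tau>) < \<delta> l) \<le> \<epsilon> P(X*_\<tau> \<ge> l)\<close>,
  with \<open>\<beta>\<close> from controllability. To see this, let \<open>T\<close> be the first time that \<open>|X|\<close> reaches \<open>l\<close>. On the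
  event on the left, \<open>\<tau>\<close> is at most a deterministic time \<open>t\<close> with \<open>g(t) \<le> \<delta> l\<close>, so \<open>T \<le> \<tau>\<close> and the path
  restarted at \<open>T\<close>, which begins at distance \<open>l\<close> from \<open>0\<close>, reaches \<open>\<beta> l\<close> within time \<open>t\<close>. By the strong
  Markov property this has probability at most \<open>P(T \<le> \<tau>)\<close> times the largest probability of such a climb
  from \<open>\<plusminus>l\<close>, and \<open>P(T \<le> \<tau>) \<le> P(X*_\<tau> \<ge> l)\<close> (\<open>prob_running_max_le_before\<close>). Controllability replaces the
  probability of the climb by \<open>C P(X*_t \<ge> \<gamma> l)\<close> for the process started at \<open>0\<close>, and Markov's inequality
  with the moment hypothesis at the deterministic time \<open>t\<close> bounds this by \<open>C C\<^sub>p (\<delta>/\<gamma>)\<^sup>p\<close>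
  (\<open>prob_running_max_moment_bound\<close>).

  To pass from tail probabilities to \<open>F\<close>, one integrates over \<open>l\<close> against the measure \<open>dF\<close> and uses
  Tonelli's theorem: this gives
  \<open>E F(X*_\<tau> / \<beta>) \<le> \<epsilon> E F(X*_\<tau>) + E F(g(\<tau>) / \<delta>)\<close>.
  A moderate function changes by at most a constant factor under dilation (\<open>moderate_dilation\<close>), so for
  small \<open>\<epsilon>\<close> the first term on the right is at most half of the left-hand side and can be absorbed, and
  the last term is a multiple of \<open>E F(g(\<tau>))\<close> (\<open>good_lambda_bounded\<close>). Absorption needs finiteness, hence
  one first works with \<open>min \<tau> n\<close> and with the maximum capped at \<open>n\<close>, and lets \<open>n\<close> tend to \<open>\<infinity>\<close>;
  continuity of \<open>F\<close> makes the left-hand side converge (\<open>mono_extension_SUP\<close>).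
\<close>

section \<open>Moderate functions and the good-\<lambda> argument\<close>

lemma mono_extension_mono:
  assumes "mono_on {0..} f" and "x \<le> y"
  shows "mono_extension f x \<le> mono_extension f y"
proof (cases "y = \<infinity>")
  case False
  with \<open>x \<le> y\<close> have "x \<noteq> \<infinity>" "enn2real x \<le> enn2real y"
    by (auto simp: top_unique less_top intro!: enn2real_mono)
  with False assms(1) show ?thesis
    by (auto simp: mono_extension_def intro!: ennreal_leI mono_onD[OF assms(1)])
qed (auto simp: mono_extension_def intro!: SUP_upper)

lemma mono_extension_ennreal [simp]: "0 \<le> x \<Longrightarrow> mono_extension f (ennreal x) = ennreal (f x)"
  by (simp add: mono_extension_def)

text \<open>
  The measure \<open>dF\<close> on \<open>(0,\<infinity>)\<close>, which turns \<open>F\<close> into the size of an interval. Since \<open>F\<close> is continuous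
  there are no atoms, so the right end may be included or not: the closed version suits the
  layer-cake formula, the open one suits suprema of increasing sequences.
\<close>

lemma mono_extension_as_measure:
  fixes F :: "real \<Rightarrow> real"
  assumes cont: "continuous_on {0..} F" and mono: "mono_on {0..} F" and "F 0 = 0"
  obtains \<nu> :: "real measure" where "sigma_finite_measure \<nu>" "sets \<nu> = sets borel"
    "\<And>x. mono_extension F x = emeasure \<nu> {l. 0 < l \<and> ennreal l \<le> x}"
    "\<And>x. mono_extension F x = emeasure \<nu> {l. 0 < l \<and> ennreal l < x}"
proof -
  define G where "G = (\<lambda>x. F (max 0 x))"
  have mono_G: "G x \<le> G y" if "x \<le> y" for x y
    using that by (auto simp: G_def intro!: mono_onD[OF mono])
  have cont_G: "continuous_on UNIV G"
    unfolding G_def by (intro continuous_on_compose2[OF cont] continuous_intros) auto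
  have right_cont_G: "continuous (at_right a) G" for a
    using cont_G by (simp add: continuous_on_eq_continuous_at continuous_at_imp_continuous_at_within)
  define \<nu> where "\<nu> = interval_measure G"
  have sets[measurable_cong, simp]: "sets \<nu> = sets borel" by (simp add: \<nu>_def)
  have Ioc: "emeasure \<nu> {0<..r} = ennreal (F r)" if "0 \<le> r" for r
    using emeasure_interval_measure_Ioc[of 0 r G, OF that mono_G right_cont_G] that \<open>F 0 = 0\<close>
    by (simp add: \<nu>_def G_def)
  have Ioo: "emeasure \<nu> {0<..<r} = ennreal (F r)" if "0 \<le> r" for r
  proof (cases "r = 0")
    case False
    have "emeasure \<nu> {r..r} = 0"
      using emeasure_interval_measure_Icc[of r r G, OF _ mono_G cont_G] by (simp add: \<nu>_def)
    then have "emeasure \<nu> ({0<..<r} \<union> {r..r}) = emeasure \<nu> {0<..<r}"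
      by (intro emeasure_Un_null_set) (auto simp: null_sets_def)
    also have "{0<..<r} \<union> {r..r} = {0<..r}"
      using that False by auto
    finally show ?thesis using Ioc[OF that] by simp
  qed (use \<open>F 0 = 0\<close> in auto)
  have Ioi: "emeasure \<nu> {0<..} = mono_extension F \<infinity>"
  proof -
    have "emeasure \<nu> {0<..} = emeasure \<nu> (\<Union>n::nat. {0<..real n})"
      by (rule arg_cong[where f = "emeasure \<nu>"]) (auto simp: real_arch_simple)
    also have "\<dots> = (SUP n::nat. emeasure \<nu> {0<..real n})"
      by (intro SUP_emeasure_incseq[symmetric]) (auto simp: incseq_def)
    also have "\<dots> = (SUP n::nat. ennreal (F (real n)))" by (simp add: Ioc)
    also have "\<dots> = (SUP y\<in>{0..}. ennreal (F y))"
    proof (rule antisym)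
      show "(SUP y\<in>{0..}. ennreal (F y)) \<le> (SUP n::nat. ennreal (F (real n)))"
      proof (rule SUP_least)
        fix y :: real assume "y \<in> {0..}"
        moreover obtain n :: nat where "y \<le> real n" using real_arch_simple by blast
        ultimately show "ennreal (F y) \<le> (SUP n::nat. ennreal (F (real n)))"
          by (intro SUP_upper2[of n] ennreal_leI mono_onD[OF mono]) auto
      qed
    qed (auto intro!: SUP_least SUP_upper)
    also have "\<dots> = mono_extension F \<infinity>" by (simp add: mono_extension_def)
    finally show ?thesis .
  qed
  show thesis
  proof (rule that[of \<nu>])
    show "sigma_finite_measure \<nu>"
      unfolding \<nu>_def by (rule sigma_finite_interval_measure[OF mono_G right_cont_G])
    fix x :: ennreal
    show "mono_extension F x = emeasure \<nu> {l. 0 < l \<and> ennreal l \<le> x}"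
    proof (cases x)
      case (real r)
      then have "{l. 0 < l \<and> ennreal l \<le> x} = {0<..r}" by auto
      with real Ioc show ?thesis by simp
    next
      case top
      then have "{l. 0 < l \<and> ennreal l \<le> x} = {0<..}" by auto
      with top Ioi show ?thesis by simp
    qed
    show "mono_extension F x = emeasure \<nu> {l. 0 < l \<and> ennreal l < x}"
    proof (cases x)
      case (real r)
      then have "{l. 0 < l \<and> ennreal l < x} = {0<..<r}" by (auto simp: ennreal_less_iff)
      with real Ioo show ?thesis by simp
    next
      case top
      then have "{l. 0 < l \<and> ennreal l < x} = {0<..}" by auto
      with top Ioi show ?thesis by simp
    qed
  qed simp
qed

lemma mono_extension_SUP:
  assumes "continuous_on {0..} F" "mono_on {0..} F" "F 0 = 0" and "incseq a"
  shows "mono_extension F (SUP n. a n) = (SUP n::nat. mono_extension F (a n))"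
proof -
  obtain \<nu> where [measurable_cong, simp]: "sets \<nu> = sets borel"
    and \<nu>: "\<And>x. mono_extension F x = emeasure \<nu> {l. 0 < l \<and> ennreal l < x}"
    using mono_extension_as_measure[OF assms(1-3)] by metis
  have "(SUP n. emeasure \<nu> {l. 0 < l \<and> ennreal l < a n}) = emeasure \<nu> (\<Union>n. {l. 0 < l \<and> ennreal l < a n})"
  proof (rule SUP_emeasure_incseq)
    have "{l. 0 < l \<and> ennreal l < a n} \<in> sets borel" for n by measurable
    then show "range (\<lambda>n. {l. 0 < l \<and> ennreal l < a n}) \<subseteq> sets \<nu>" by auto
    show "incseq (\<lambda>n. {l. 0 < l \<and> ennreal l < a n})"
      using \<open>incseq a\<close> by (fastforce simp: incseq_def intro: less_le_trans)
  qed
  also have "(\<Union>n. {l. 0 < l \<and> ennreal l < a n}) = {l. 0 < l \<and> ennreal l < (SUP n. a n)}"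
    by (auto simp: less_SUP_iff)
  finally show ?thesis by (simp add: \<nu>)
qed

lemma measurable_mono_extension:
  assumes "continuous_on {0..} F" "mono_on {0..} F" "F 0 = 0"
    and [measurable]: "U \<in> borel_measurable K"
  shows "(\<lambda>\<omega>. mono_extension F (U \<omega>)) \<in> borel_measurable K"
proof -
  obtain \<nu> where "sigma_finite_measure \<nu>" and [measurable_cong, simp]: "sets \<nu> = sets borel"
    and \<nu>: "\<And>x. mono_extension F x = emeasure \<nu> {l. 0 < l \<and> ennreal l < x}"
    using mono_extension_as_measure[OF assms(1-3)] by metis
  interpret sigma_finite_measure \<nu> by fact
  have "(\<lambda>\<omega>. \<integral>\<^sup>+l. indicator {l. 0 < l \<and> ennreal l < U \<omega>} l \<partial>\<nu>) \<in> borel_measurable K"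
    unfolding indicator_def by measurable
  moreover have "{l. 0 < l \<and> ennreal l < U \<omega>} \<in> sets borel" for \<omega> by measurable
  ultimately show ?thesis by (simp add: \<nu>)
qed

text \<open>
  \<open>E F(U) = \<integral> P(U \<ge> l) dF(l)\<close>, which is Tonelli's theorem for the region \<open>0 < l \<le> U\<close>. It is how
  inequalities between tail probabilities become inequalities between expectations of \<open>F\<close>.
\<close>

lemma nn_integral_mono_extension_layer_cake:
  assumes \<nu>: "sigma_finite_measure \<nu>" "sets \<nu> = sets borel"
    "\<And>x. mono_extension F x = emeasure \<nu> {l. 0 < l \<and> ennreal l \<le> x}"
    and "finite_measure M" and U [measurable]: "U \<in> borel_measurable M"
  shows "(\<integral>\<^sup>+\<omega>. mono_extension F (U \<omega>) \<partial>M)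
    = (\<integral>\<^sup>+l. indicator {0<..} l * emeasure M {\<omega>\<in>space M. ennreal l \<le> U \<omega>} \<partial>\<nu>)"
proof -
  note [measurable_cong] = \<nu>(2)
  interpret \<nu>: sigma_finite_measure \<nu> by fact
  interpret M: finite_measure M by fact
  interpret pair_sigma_finite M \<nu> ..
  have eq: "mono_extension F (U \<omega>) = (\<integral>\<^sup>+l. indicator {l. 0 < l \<and> ennreal l \<le> U \<omega>} l \<partial>\<nu>)" for \<omega>
  proof -
    have "{l. 0 < l \<and> ennreal l \<le> U \<omega>} \<in> sets borel" by measurable
    then show ?thesis by (simp add: \<nu>)
  qed
  have meas: "(\<lambda>(\<omega>, l). indicator {l. 0 < l \<and> ennreal l \<le> U \<omega>} l :: ennreal) \<in> borel_measurable (M \<Otimes>\<^sub>M \<nu>)"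
    unfolding indicator_def by measurable
  have "(\<integral>\<^sup>+\<omega>. mono_extension F (U \<omega>) \<partial>M)
      = (\<integral>\<^sup>+\<omega>. (\<integral>\<^sup>+l. indicator {l. 0 < l \<and> ennreal l \<le> U \<omega>} l \<partial>\<nu>) \<partial>M)" by (simp add: eq)
  also have "\<dots> = (\<integral>\<^sup>+l. (\<integral>\<^sup>+\<omega>. indicator {l. 0 < l \<and> ennreal l \<le> U \<omega>} l \<partial>M) \<partial>\<nu>)"
    by (rule Fubini'[OF meas, symmetric])
  also have "\<dots> = (\<integral>\<^sup>+l. indicator {0<..} l * emeasure M {\<omega>\<in>space M. ennreal l \<le> U \<omega>} \<partial>\<nu>)"
  proof (rule nn_integral_cong)
    fix l
    have "(\<integral>\<^sup>+\<omega>. indicator {l. 0 < l \<and> ennreal l \<le> U \<omega>} l \<partial>M)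
        = (\<integral>\<^sup>+\<omega>. indicator {0<..} l * indicator {\<omega>\<in>space M. ennreal l \<le> U \<omega>} \<omega> \<partial>M)"
      by (intro nn_integral_cong) (auto simp: indicator_def)
    also have "\<dots> = indicator {0<..} l * emeasure M {\<omega>\<in>space M. ennreal l \<le> U \<omega>}"
      by (simp add: nn_integral_cmult)
    finally show "(\<integral>\<^sup>+\<omega>. indicator {l. 0 < l \<and> ennreal l \<le> U \<omega>} l \<partial>M) = \<dots>" .
  qed
  finally show "(\<integral>\<^sup>+\<omega>. mono_extension F (U \<omega>) \<partial>M)
    = (\<integral>\<^sup>+l. indicator {0<..} l * emeasure M {\<omega>\<in>space M. ennreal l \<le> U \<omega>} \<partial>\<nu>)" .
qed

lemma moderateD:
  assumes "moderate F"
  shows "continuous_on {0..} F" "mono_on {0..} F" "F 0 = 0"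
  using assms by (auto simp: moderate_def)

text \<open>
  The defining growth condition only compares \<open>F\<close> at \<open>x\<close> and \<open>\<beta>x\<close> for a single \<open>\<beta> > 1\<close>. Iterating it
  reaches every dilation factor \<open>a\<close>, because some power of \<open>\<beta>\<close> exceeds \<open>a\<close>. The constant is taken
  at least \<open>1\<close> so that the inequality persists at \<open>x = \<infinity>\<close>.
\<close>

lemma moderate_dilation:
  assumes "moderate F"
  obtains K where "1 \<le> K" "\<And>x. mono_extension F (ennreal a * x) \<le> ennreal K * mono_extension F x"
proof -
  note F = moderateD[OF assms]
  have F_nonneg: "0 \<le> F x" if "0 \<le> x" for x
    using mono_onD[OF F(2), of 0 x] that F(3) by simp
  obtain \<beta> where \<beta>: "1 < \<beta>" "(SUP x\<in>{0<..}. ratio (F (\<beta> * x)) (F x)) < \<infinity>"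
    using assms by (auto simp: moderate_def)
  define K where "K = max 1 (enn2real (SUP x\<in>{0<..}. ratio (F (\<beta> * x)) (F x)))"
  have step: "F (\<beta> * x) \<le> K * F x" if "0 \<le> x" for x
  proof (cases "x = 0")
    case False
    with that have "0 < x" by simp
    have "ratio (F (\<beta> * x)) (F x) \<le> (SUP x\<in>{0<..}. ratio (F (\<beta> * x)) (F x))"
      using \<open>0 < x\<close> by (intro SUP_upper) auto
    also have "\<dots> = ennreal (enn2real (SUP x\<in>{0<..}. ratio (F (\<beta> * x)) (F x)))"
      using \<beta>(2) by simp
    also have "\<dots> \<le> ennreal K" by (intro ennreal_leI) (simp add: K_def)
    finally have le: "ratio (F (\<beta> * x)) (F x) \<le> ennreal K" .
    show ?thesis
    proof (cases "F x = 0")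
      case True
      with le show ?thesis by (auto simp: ratio_def top_unique split: if_splits)
    next
      case False
      then have "0 < F x" using F_nonneg[of x] that by simp
      moreover have "F (\<beta> * x) / F x \<le> K"
        using le False by (simp add: ratio_def K_def ennreal_le_iff)
      ultimately show ?thesis by (simp add: field_simps)
    qed
  qed (simp add: F)
  have iter: "F (\<beta> ^ n * x) \<le> K ^ n * F x" if "0 \<le> x" for x n
  proof (induction n)
    case (Suc n)
    have "F (\<beta> ^ Suc n * x) \<le> K * F (\<beta> ^ n * x)"
      using step[of "\<beta> ^ n * x"] that \<beta>(1) by (simp add: mult.assoc)
    also have "\<dots> \<le> K * (K ^ n * F x)"
      using Suc by (intro mult_left_mono) (auto simp: K_def)
    finally show ?case by (simp add: mult.assoc)
  qed simp
  obtain n where n: "a < \<beta> ^ n" using real_arch_pow[OF \<beta>(1)] by blast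
  show thesis
  proof (rule that)
    show "1 \<le> K ^ n" by (rule one_le_power) (simp add: K_def)
    fix x
    show "mono_extension F (ennreal a * x) \<le> ennreal (K ^ n) * mono_extension F x"
    proof (cases x)
      case (real r)
      have "mono_extension F (ennreal a * x) \<le> mono_extension F (ennreal (\<beta> ^ n * r))"
        using real n \<beta>(1) unfolding real
        by (intro mono_extension_mono[OF F(2)])
          (auto simp: ennreal_mult intro!: mult_right_mono ennreal_leI)
      also have "\<dots> \<le> ennreal (K ^ n * F r)"
        using real iter[of r n] \<beta>(1) by (auto intro!: ennreal_leI)
      also have "\<dots> = ennreal (K ^ n) * mono_extension F x"
        using real by (simp add: ennreal_mult K_def F_nonneg)
      finally show ?thesis .
    next
      case top
      have "mono_extension F (ennreal a * x) \<le> 1 * mono_extension F x"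
        using top by (auto intro!: mono_extension_mono[OF F(2)])
      also have "\<dots> \<le> ennreal (K ^ n) * mono_extension F x"
        using \<open>1 \<le> K ^ n\<close> by (intro mult_right_mono) auto
      finally show ?thesis .
    qed
  qed
qed

lemma ennreal_mult_inverse_le_iff:
  assumes "0 < \<beta>"
  shows "ennreal l \<le> ennreal (1 / \<beta>) * x \<longleftrightarrow> ennreal (\<beta> * l) \<le> x"
proof (cases x)
  case (real r)
  show ?thesis
  proof (cases "0 \<le> l")
    case True with real assms show ?thesis
      by (simp add: ennreal_mult[symmetric] ennreal_le_iff field_simps)
  next
    case False
    then have "\<beta> * l < 0" using assms by (simp add: mult_pos_neg)
    then show ?thesis using False by (simp add: ennreal_neg)
  qed
next
  case top with assms show ?thesis by (simp add: ennreal_mult_top)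
qed

text \<open>
  The good-\<open>\<lambda>\<close> argument. Put \<open>V = U/\<beta>\<close>. If \<open>V \<ge> l\<close> then either \<open>dZ \<ge> l\<close>, or the hypothesis \<open>tail\<close>
  applies; integrating against \<open>dF\<close> gives \<open>E F(V) \<le> \<epsilon> E F(U) + E F(dZ)\<close>. The first term is at most
  \<open>\<epsilon>K E F(V) \<le> E F(V)/2\<close> by the dilation bound and can be absorbed into the left-hand side, provided
  this is finite. That is what the boundedness of \<open>U\<close> is for; the final bound does not involve \<open>m\<close>.
\<close>

lemma good_lambda_bounded:
  fixes U Z :: "'a \<Rightarrow> ennreal"
  assumes "finite_measure M"
    and F: "continuous_on {0..} F" "mono_on {0..} F" "F 0 = 0"
    and [measurable]: "U \<in> borel_measurable M" "Z \<in> borel_measurable M"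
    and bounded: "\<And>\<omega>. U \<omega> \<le> ennreal m"
    and \<beta>: "0 < \<beta>" "\<And>x. mono_extension F (ennreal \<beta> * x) \<le> ennreal K * mono_extension F x"
    and d: "\<And>x. mono_extension F (ennreal d * x) \<le> ennreal L * mono_extension F x"
    and tail: "\<And>l. 0 < l \<Longrightarrow>
      measure M {\<omega>\<in>space M. ennreal (\<beta> * l) \<le> U \<omega> \<and> ennreal d * Z \<omega> < ennreal l}
        \<le> \<epsilon> * measure M {\<omega>\<in>space M. ennreal l \<le> U \<omega>}"
    and small: "0 \<le> \<epsilon>" "0 \<le> K" "0 \<le> L" "\<epsilon> * K \<le> 1 / 2"
  shows "(\<integral>\<^sup>+\<omega>. mono_extension F (U \<omega>) \<partial>M) \<le> ennreal (2 * K * L) * (\<integral>\<^sup>+\<omega>. mono_extension F (Z \<omega>) \<partial>M)"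
proof -
  interpret M: finite_measure M by fact
  obtain \<nu> where \<nu>: "sigma_finite_measure \<nu>" "sets \<nu> = sets borel"
    "\<And>x. mono_extension F x = emeasure \<nu> {l. 0 < l \<and> ennreal l \<le> x}"
    using mono_extension_as_measure[OF F] by metis
  note [measurable_cong] = \<nu>(2)
  note layer_cake = nn_integral_mono_extension_layer_cake[OF \<nu> M.finite_measure_axioms]
  define V where "V = (\<lambda>\<omega>. ennreal (1 / \<beta>) * U \<omega>)"
  have [measurable]: "V \<in> borel_measurable M" by (simp add: V_def)
  have U_eq: "U \<omega> = ennreal \<beta> * V \<omega>" for \<omega>
    using \<beta>(1) by (simp add: V_def mult.assoc[symmetric] ennreal_mult[symmetric])
  define I where "I = (\<integral>\<^sup>+\<omega>. mono_extension F (V \<omega>) \<partial>M)"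
  define J where "J = (\<integral>\<^sup>+\<omega>. mono_extension F (ennreal d * Z \<omega>) \<partial>M)"
  have U_le: "(\<integral>\<^sup>+\<omega>. mono_extension F (U \<omega>) \<partial>M) \<le> ennreal K * I"
  proof -
    have "(\<integral>\<^sup>+\<omega>. mono_extension F (U \<omega>) \<partial>M) \<le> (\<integral>\<^sup>+\<omega>. ennreal K * mono_extension F (V \<omega>) \<partial>M)"
      by (intro nn_integral_mono) (simp add: U_eq \<beta>(2))
    also have "\<dots> = ennreal K * I"
      unfolding I_def by (intro nn_integral_cmult measurable_mono_extension F) measurable
    finally show ?thesis .
  qed
  have "I < \<infinity>"
  proof -
    have "I \<le> (\<integral>\<^sup>+\<omega>. ennreal (F (1 / \<beta> * max 0 m)) \<partial>M)"
      unfolding I_def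
    proof (intro nn_integral_mono)
      fix \<omega>
      have "V \<omega> \<le> ennreal (1 / \<beta>) * ennreal (max 0 m)"
        unfolding V_def using bounded[of \<omega>]
        by (intro mult_left_mono) (auto simp: max_def ennreal_neg split: if_splits)
      also have "\<dots> = ennreal (1 / \<beta> * max 0 m)"
        using \<beta>(1) by (intro ennreal_mult[symmetric]) auto
      finally have "mono_extension F (V \<omega>) \<le> mono_extension F (ennreal (1 / \<beta> * max 0 m))"
        by (rule mono_extension_mono[OF F(2)])
      then show "mono_extension F (V \<omega>) \<le> ennreal (F (1 / \<beta> * max 0 m))"
        using \<beta>(1) by (subst (asm) mono_extension_ennreal) auto
    qed
    also have "\<dots> < \<infinity>"
      by (simp add: M.emeasure_eq_measure ennreal_mult_less_top)
    finally show ?thesis .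
  qed
  have tail_le: "emeasure M {\<omega>\<in>space M. ennreal l \<le> V \<omega>}
      \<le> ennreal \<epsilon> * emeasure M {\<omega>\<in>space M. ennreal l \<le> U \<omega>}
        + emeasure M {\<omega>\<in>space M. ennreal l \<le> ennreal d * Z \<omega>}" if "0 < l" for l
  proof -
    have "emeasure M {\<omega>\<in>space M. ennreal l \<le> V \<omega>}
      \<le> emeasure M ({\<omega>\<in>space M. ennreal (\<beta> * l) \<le> U \<omega> \<and> ennreal d * Z \<omega> < ennreal l}
          \<union> {\<omega>\<in>space M. ennreal l \<le> ennreal d * Z \<omega>})"
      by (intro emeasure_mono) (auto simp: V_def ennreal_mult_inverse_le_iff[OF \<beta>(1)])
    also have "\<dots> \<le> emeasure M {\<omega>\<in>space M. ennreal (\<beta> * l) \<le> U \<omega> \<and> ennreal d * Z \<omega> < ennreal l}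
        + emeasure M {\<omega>\<in>space M. ennreal l \<le> ennreal d * Z \<omega>}"
      by (intro emeasure_subadditive) measurable
    also have "emeasure M {\<omega>\<in>space M. ennreal (\<beta> * l) \<le> U \<omega> \<and> ennreal d * Z \<omega> < ennreal l}
        \<le> ennreal \<epsilon> * emeasure M {\<omega>\<in>space M. ennreal l \<le> U \<omega>}"
      using tail[OF that] small(1)
      by (simp add: M.emeasure_eq_measure ennreal_mult[symmetric] ennreal_leI)
    finally show ?thesis by (simp add: add_right_mono)
  qed
  have meas_tail [measurable]: "(\<lambda>l. emeasure M {\<omega>\<in>space M. ennreal l \<le> W \<omega>}) \<in> borel_measurable \<nu>"
    if [measurable]: "W \<in> borel_measurable M" for W
  proof -
    have "(\<lambda>l. \<integral>\<^sup>+\<omega>. indicator {\<omega>\<in>space M. ennreal l \<le> W \<omega>} \<omega> \<partial>M) \<in> borel_measurable \<nu>"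
      unfolding indicator_def by measurable
    then show ?thesis by simp
  qed
  have "I \<le> (\<integral>\<^sup>+l. ennreal \<epsilon> * (indicator {0<..} l * emeasure M {\<omega>\<in>space M. ennreal l \<le> U \<omega>})
      + indicator {0<..} l * emeasure M {\<omega>\<in>space M. ennreal l \<le> ennreal d * Z \<omega>} \<partial>\<nu>)"
    unfolding I_def layer_cake[OF \<open>V \<in> borel_measurable M\<close>]
    using tail_le by (intro nn_integral_mono) (auto simp: indicator_def)
  also have "\<dots> = ennreal \<epsilon> * (\<integral>\<^sup>+\<omega>. mono_extension F (U \<omega>) \<partial>M) + J"
    unfolding J_def
    by (subst nn_integral_add, measurable, subst nn_integral_cmult, measurable, subst (1 2) layer_cake, measurable)
  also have "\<dots> \<le> ennreal \<epsilon> * (ennreal K * I) + J"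
    by (intro add_right_mono mult_left_mono U_le) auto
  also have "\<dots> \<le> ennreal (1 / 2) * I + J"
  proof (rule add_right_mono)
    have "ennreal \<epsilon> * (ennreal K * I) = ennreal (\<epsilon> * K) * I"
      using small by (simp add: ennreal_mult mult.assoc)
    also have "\<dots> \<le> ennreal (1 / 2) * I"
      by (intro mult_right_mono ennreal_leI small) auto
    finally show "ennreal \<epsilon> * (ennreal K * I) \<le> ennreal (1 / 2) * I" .
  qed
  finally have "I \<le> ennreal (1 / 2) * I + J" .
  \<comment> \<open>Absorption: subtracting \<open>I / 2\<close> is legitimate because \<open>I\<close> is finite.\<close>
  then have "I \<le> 2 * J"
  proof (cases J)
    case (real j)
    moreover obtain i where "0 \<le> i" "I = ennreal i"
      using \<open>I < \<infinity>\<close> by (cases I) auto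
    ultimately have "ennreal (1 / 2) * I + J = ennreal (1 / 2 * i + j)"
      by (subst ennreal_plus, simp, simp, subst ennreal_mult) auto
    with \<open>I \<le> ennreal (1 / 2) * I + J\<close> have "ennreal i \<le> ennreal (1 / 2 * i + j)"
      using \<open>I = ennreal i\<close> by simp
    then have "i \<le> 1 / 2 * i + j"
      using real \<open>0 \<le> i\<close> by (subst (asm) ennreal_le_iff) auto
    then have "ennreal i \<le> ennreal (2 * j)" by (intro ennreal_leI) simp
    with real \<open>I = ennreal i\<close> show ?thesis by (simp add: ennreal_mult)
  next
    case top then show ?thesis by (simp add: ennreal_mult_top)
  qed
  have "J \<le> ennreal L * (\<integral>\<^sup>+\<omega>. mono_extension F (Z \<omega>) \<partial>M)"
  proof -
    have "J \<le> (\<integral>\<^sup>+\<omega>. ennreal L * mono_extension F (Z \<omega>) \<partial>M)"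
      unfolding J_def by (intro nn_integral_mono) (simp add: d)
    then show ?thesis
      by (subst (asm) nn_integral_cmult) (auto intro: measurable_mono_extension F)
  qed
  then have "ennreal K * I \<le> ennreal K * (2 * (ennreal L * (\<integral>\<^sup>+\<omega>. mono_extension F (Z \<omega>) \<partial>M)))"
    by (intro mult_left_mono order_trans[OF \<open>I \<le> 2 * J\<close>]) auto
  also have "\<dots> = ennreal (2 * K * L) * (\<integral>\<^sup>+\<omega>. mono_extension F (Z \<omega>) \<partial>M)"
    using small by (simp add: ennreal_mult ac_simps)
  finally show ?thesis using U_le by (rule order_trans[rotated])
qed

section \<open>The running maximum of a continuous path\<close>

lemma running_max_upper: "0 \<le> s \<Longrightarrow> ennreal s \<le> t \<Longrightarrow> ennreal \<bar>w s\<bar> \<le> running_max w t"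
  unfolding running_max_def by (rule SUP_upper) simp

lemma running_max_mono: "s \<le> t \<Longrightarrow> running_max w s \<le> running_max w t"
  unfolding running_max_def by (rule SUP_subset_mono) (auto intro: order_trans)

lemma running_max_SUP_min:
  "running_max w t = (SUP n::nat. running_max w (min t (of_nat n)))"
proof (rule antisym)
  show "running_max w t \<le> (SUP n::nat. running_max w (min t (of_nat n)))"
    unfolding running_max_def[of w t]
  proof (rule SUP_least)
    fix s :: real assume s: "s \<in> {s. 0 \<le> s \<and> ennreal s \<le> t}"
    obtain n :: nat where "s \<le> real n" using real_arch_simple by blast
    then have "ennreal s \<le> min t (of_nat n)"
      using s by (auto simp: ennreal_of_nat_eq_real_of_nat intro!: ennreal_leI)
    with s show "ennreal \<bar>w s\<bar> \<le> (SUP n::nat. running_max w (min t (of_nat n)))"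
      by (intro SUP_upper2[of n] running_max_upper) auto
  qed
qed (auto intro!: SUP_least running_max_mono)

lemma running_max_attained:
  assumes cont: "continuous_on {0..} w" and "t < \<infinity>"
  obtains s where "0 \<le> s" "ennreal s \<le> t" "running_max w t = ennreal \<bar>w s\<bar>"
proof -
  obtain r where r: "0 \<le> r" "t = ennreal r" using \<open>t < \<infinity>\<close> by (cases t) auto
  have "continuous_on {0..r} (\<lambda>s. \<bar>w s\<bar>)"
    by (intro continuous_intros continuous_on_subset[OF cont]) auto
  then obtain s where s: "s \<in> {0..r}" "\<And>u. u \<in> {0..r} \<Longrightarrow> \<bar>w u\<bar> \<le> \<bar>w s\<bar>"
    using continuous_attains_sup[of "{0..r}" "\<lambda>s. \<bar>w s\<bar>"] r by auto
  show thesis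
  proof (rule that[of s])
    show "running_max w t = ennreal \<bar>w s\<bar>"
      using s r by (intro antisym running_max_upper)
        (auto simp: running_max_def intro!: SUP_least ennreal_leI)
  qed (use s r in \<open>auto intro: ennreal_leI\<close>)
qed

text \<open>
  Over rational times the supremum becomes countable. Putting the constraint \<open>q \<le> t\<close> inside the
  supremum makes the index set independent of \<open>t\<close>, which gives measurability also when \<open>t\<close> is random.
\<close>

lemma running_max_eq_SUP_Rats:
  assumes cont: "continuous_on {0..} w"
  shows "running_max w t = (SUP q\<in>\<rat> \<inter> {0..}. if ennreal q \<le> t then ennreal \<bar>w q\<bar> else 0)"
    (is "_ = ?R")
proof (rule antisym)
  show "running_max w t \<le> ?R"
    unfolding running_max_def
  proof (rule SUP_least)
    fix s assume s: "s \<in> {s. 0 \<le> s \<and> ennreal s \<le> t}"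
    show "ennreal \<bar>w s\<bar> \<le> ?R"
    proof (cases "s = 0")
      case True
      then show ?thesis by (intro SUP_upper2[of 0]) auto
    next
      case False
      with s have "0 < s" by simp
      show ?thesis
      proof (rule dense_le)
        fix y assume y: "y < ennreal \<bar>w s\<bar>"
        have "continuous_on {0..} (\<lambda>u. ennreal \<bar>w u\<bar>)"
          by (intro continuous_on_ennreal continuous_intros cont)
        moreover have "s \<in> {0..}" using s by simp
        ultimately have "((\<lambda>u. ennreal \<bar>w u\<bar>) \<longlongrightarrow> ennreal \<bar>w s\<bar>) (at s within {0..})"
          unfolding continuous_on_def by blast
        then have "eventually (\<lambda>u. y < ennreal \<bar>w u\<bar>) (at s within {0..})"
          using y by (rule order_tendstoD(1))
        then obtain d where d: "0 < d"
          "\<And>u. 0 \<le> u \<Longrightarrow> u \<noteq> s \<Longrightarrow> \<bar>u - s\<bar> < d \<Longrightarrow> y < ennreal \<bar>w u\<bar>"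
          by (auto simp: eventually_at dist_real_def)
        obtain q where q: "q \<in> \<rat>" "max 0 (s - d) < q" "q < s"
          using Rats_dense_in_real[of "max 0 (s - d)" s] \<open>0 < s\<close> \<open>0 < d\<close> by auto
        then have "ennreal q \<le> ennreal s" "y < ennreal \<bar>w q\<bar>"
          using d(2)[of q] by (auto intro: ennreal_leI)
        moreover from this(1) have "ennreal q \<le> t" using s by (metis (lifting) mem_Collect_eq order_trans)
        ultimately show "y \<le> ?R" using q by (intro SUP_upper2[of q]) auto
      qed
    qed
  qed
  show "?R \<le> running_max w t"
    by (intro SUP_least) (auto intro: running_max_upper)
qed

text \<open>
  \<open>Y q\<close> need only be measurable for times \<open>q\<close> that \<open>T\<close> can reach. With a constant \<open>T = t\<close> and \<open>K\<close> the
  \<open>\<sigma>\<close>-algebra at time \<open>t\<close>, this says that the running maximum of an adapted process is adapted.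
\<close>

lemma measurable_running_max:
  assumes Y: "\<And>q. 0 \<le> q \<Longrightarrow> \<exists>\<omega>\<in>space K. ennreal q \<le> T \<omega> \<Longrightarrow> Y q \<in> borel_measurable K"
    and T [measurable]: "T \<in> borel_measurable K"
    and cont: "\<And>\<omega>. \<omega> \<in> space K \<Longrightarrow> continuous_on {0..} (\<lambda>s. Y s \<omega>)"
  shows "(\<lambda>\<omega>. running_max (\<lambda>s. Y s \<omega>) (T \<omega>)) \<in> borel_measurable K"
proof (subst measurable_cong[OF running_max_eq_SUP_Rats[OF cont]], assumption)
  show "(\<lambda>\<omega>. SUP q\<in>\<rat> \<inter> {0..}. if ennreal q \<le> T \<omega> then ennreal \<bar>Y q \<omega>\<bar> else 0) \<in> borel_measurable K"
  proof (rule borel_measurable_SUP)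
    show "countable (\<rat> \<inter> {0..} :: real set)" by (simp add: countable_rat)
    fix q :: real assume "q \<in> \<rat> \<inter> {0..}"
    show "(\<lambda>\<omega>. if ennreal q \<le> T \<omega> then ennreal \<bar>Y q \<omega>\<bar> else 0) \<in> borel_measurable K"
    proof (cases "\<exists>\<omega>\<in>space K. ennreal q \<le> T \<omega>")
      case True
      with Y \<open>q \<in> _\<close> have [measurable]: "Y q \<in> borel_measurable K" by simp
      show ?thesis by measurable
    next
      case False
      then show ?thesis by (subst measurable_cong[where g = "\<lambda>_. 0"]) auto
    qed
  qed
qed

text \<open>
  Approximate \<open>S\<close> from above by random times with countably many values: the integer multiples
  of \<open>1/(n+1)\<close>. Continuity of the paths gives the limit.
\<close>

lemma measurable_at_random_time:
  fixes Y :: "real \<Rightarrow> 'a \<Rightarrow> real"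
  assumes Y: "\<And>s. 0 \<le> s \<Longrightarrow> Y s \<in> borel_measurable K"
    and S [measurable]: "S \<in> borel_measurable K" and S_nonneg: "\<And>\<omega>. 0 \<le> S \<omega>"
    and cont: "\<And>\<omega>. \<omega> \<in> space K \<Longrightarrow> continuous_on {0..} (\<lambda>s. Y s \<omega>)"
  shows "(\<lambda>\<omega>. Y (S \<omega>) \<omega>) \<in> borel_measurable K"
proof (rule borel_measurable_LIMSEQ_real)
  define a where "a n \<omega> = nat \<lceil>real (Suc n) * S \<omega>\<rceil>" for n \<omega>
  have [measurable]: "a n \<in> measurable K (count_space UNIV)" for n
    unfolding a_def by measurable
  show "(\<lambda>\<omega>. Y (real (a n \<omega>) / real (Suc n)) \<omega>) \<in> borel_measurable K" for n
    by (rule measurable_compose_countable[where f = "\<lambda>k \<omega>. Y (real k / real (Suc n)) \<omega>" and g = "a n"])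
      (auto intro!: Y)
  fix \<omega> assume \<omega>: "\<omega> \<in> space K"
  have "(\<lambda>n. real (a n \<omega>) / real (Suc n)) \<longlonglongrightarrow> S \<omega>"
  proof (rule tendsto_sandwich)
    show "\<forall>\<^sub>F n in sequentially. S \<omega> \<le> real (a n \<omega>) / real (Suc n)"
      unfolding a_def by (intro always_eventually allI) (simp add: field_simps del: of_nat_Suc, linarith)
    show "\<forall>\<^sub>F n in sequentially. real (a n \<omega>) / real (Suc n) \<le> S \<omega> + 1 / real (Suc n)"
    proof (intro always_eventually allI)
      fix n
      have "0 \<le> real (Suc n) * S \<omega>" using S_nonneg[of \<omega>] by simp
      then have "real (a n \<omega>) \<le> real (Suc n) * S \<omega> + 1"
        unfolding a_def by linarith
      then show "real (a n \<omega>) / real (Suc n) \<le> S \<omega> + 1 / real (Suc n)"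
        by (simp add: field_simps del: of_nat_Suc)
    qed
    show "(\<lambda>n. S \<omega> + 1 / real (Suc n)) \<longlonglongrightarrow> S \<omega>"
      using tendsto_add[OF tendsto_const LIMSEQ_inverse_real_of_nat, of "S \<omega>"]
      by (simp add: inverse_eq_divide)
  qed auto
  then show "(\<lambda>n. Y (real (a n \<omega>) / real (Suc n)) \<omega>) \<longlonglongrightarrow> Y (S \<omega>) \<omega>"
    by (rule continuous_on_tendsto_compose[OF cont[OF \<omega>]]) (auto simp: S_nonneg)
qed

section \<open>Events in path space\<close>

lemma space_path_space: "space path_space = {w. continuous_on {0..} w}"
  unfolding path_space_def by (intro space_measure_of) auto

lemma sets_path_space:
  "sets path_space = sigma_sets {w. continuous_on {0..} w}
     {{w. continuous_on {0..} w \<and> w t \<in> A} |t A. 0 \<le> t \<and> A \<in> sets borel}"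
  unfolding path_space_def by (intro sets_measure_of) auto

lemma measurable_path_eval:
  assumes "0 \<le> t"
  shows "(\<lambda>w. w t) \<in> borel_measurable path_space"
proof (rule measurableI)
  fix A :: "real set" assume "A \<in> sets borel"
  with assms have "{w. continuous_on {0..} w \<and> w t \<in> A} \<in> sets path_space"
    unfolding sets_path_space by (intro sigma_sets.Basic) auto
  also have "{w. continuous_on {0..} w \<and> w t \<in> A} = (\<lambda>w. w t) -` A \<inter> space path_space"
    by (auto simp: space_path_space)
  finally show "(\<lambda>w. w t) -` A \<inter> space path_space \<in> sets path_space" .
qed simp

lemma measurable_path_spaceI:
  fixes Y :: "real \<Rightarrow> 'a \<Rightarrow> real"
  assumes cont: "\<And>\<omega>. \<omega> \<in> space K \<Longrightarrow> continuous_on {0..} (\<lambda>s. Y s \<omega>)"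
    and Y: "\<And>s. 0 \<le> s \<Longrightarrow> Y s \<in> borel_measurable K"
  shows "(\<lambda>\<omega> s. Y s \<omega>) \<in> measurable K path_space"
proof (rule measurable_sigma_sets[OF sets_path_space])
  fix E :: "(real \<Rightarrow> real) set"
  assume "E \<in> {{w. continuous_on {0..} w \<and> w t \<in> A} |t A. 0 \<le> t \<and> A \<in> sets borel}"
  then obtain t A where "0 \<le> t" "A \<in> sets (borel :: real measure)"
    and E: "E = {w. continuous_on {0..} w \<and> w t \<in> A}" by auto
  then have "Y t -` A \<inter> space K \<in> sets K" by (intro measurable_sets[OF Y])
  also have "Y t -` A \<inter> space K = (\<lambda>\<omega> s. Y s \<omega>) -` E \<inter> space K"
    using cont by (auto simp: E)
  finally show "(\<lambda>\<omega> s. Y s \<omega>) -` E \<inter> space K \<in> sets K" .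
qed (use cont in auto)

definition paths_reaching :: "real \<Rightarrow> real \<Rightarrow> (real \<Rightarrow> real) set" where
  "paths_reaching t l = {w\<in>space path_space. ennreal l \<le> running_max w (ennreal t)}"

lemma sets_paths_reaching [measurable]: "paths_reaching t l \<in> sets path_space"
proof -
  have [measurable]: "(\<lambda>w. running_max (\<lambda>s. w s) (ennreal t)) \<in> borel_measurable path_space"
    by (rule measurable_running_max) (auto simp: measurable_path_eval space_path_space)
  show ?thesis unfolding paths_reaching_def by measurable
qed

section \<open>Hitting times\<close>

text \<open>
  The infimum is taken in the extended half-line, so that the time is \<open>\<infinity>\<close> when the level is never
  reached.
\<close>

definition hitting_time :: "(real \<Rightarrow> real) \<Rightarrow> real \<Rightarrow> ennreal" where
  "hitting_time w l = (INF s\<in>{s. 0 \<le> s \<and> l \<le> \<bar>w s\<bar>}. ennreal s)"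

lemma hitting_time_lower: "0 \<le> s \<Longrightarrow> l \<le> \<bar>w s\<bar> \<Longrightarrow> hitting_time w l \<le> ennreal s"
  unfolding hitting_time_def by (rule INF_lower) simp

lemma hitting_time_attained:
  assumes cont: "continuous_on {0..} w" and fin: "hitting_time w l < \<infinity>"
  obtains s where "0 \<le> s" "hitting_time w l = ennreal s" "l \<le> \<bar>w s\<bar>"
proof -
  define S where "S = {0..} \<inter> (\<lambda>s. \<bar>w s\<bar>) -` {l..}"
  have S: "S = {s. 0 \<le> s \<and> l \<le> \<bar>w s\<bar>}" by (auto simp: S_def)
  have "S \<noteq> {}"
  proof
    assume "S = {}"
    with fin show False by (simp add: hitting_time_def S[symmetric])
  qed
  moreover have "closed S"
    unfolding S_def
    by (intro continuous_closed_preimage continuous_intros cont closed_atLeast)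
  moreover have bdd: "bdd_below S" by (auto simp: S_def)
  ultimately have Inf: "Inf S \<in> S" by (intro closed_contains_Inf)
  show thesis
  proof (rule that)
    show "0 \<le> Inf S" "l \<le> \<bar>w (Inf S)\<bar>" using Inf by (auto simp: S)
    show "hitting_time w l = ennreal (Inf S)"
    proof (rule antisym)
      show "hitting_time w l \<le> ennreal (Inf S)"
        using Inf by (intro hitting_time_lower) (auto simp: S)
      show "ennreal (Inf S) \<le> hitting_time w l"
        unfolding hitting_time_def S[symmetric] by (auto intro!: INF_greatest ennreal_leI cInf_lower bdd)
    qed
  qed
qed

lemma hitting_time_le_iff:
  assumes cont: "continuous_on {0..} w" and "t < \<infinity>" "0 < l"
  shows "hitting_time w l \<le> t \<longleftrightarrow> ennreal l \<le> running_max w t"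
proof
  assume le: "hitting_time w l \<le> t"
  then obtain s where "0 \<le> s" "hitting_time w l = ennreal s" "l \<le> \<bar>w s\<bar>"
    using hitting_time_attained[OF cont, of l] \<open>t < \<infinity>\<close> by (metis le_less_trans)
  with le show "ennreal l \<le> running_max w t"
    by (intro order_trans[OF ennreal_leI running_max_upper]) auto
next
  assume le: "ennreal l \<le> running_max w t"
  obtain s where "0 \<le> s" "ennreal s \<le> t" "running_max w t = ennreal \<bar>w s\<bar>"
    using running_max_attained[OF cont \<open>t < \<infinity>\<close>] .
  with le show "hitting_time w l \<le> t"
    by (intro order_trans[OF hitting_time_lower]) auto
qed

text \<open>
  An overshoot would mean, by the intermediate value theorem, that the level was reached earlier.
\<close>

lemma abs_at_hitting_time:
  assumes cont: "continuous_on {0..} w" and "\<bar>w 0\<bar> \<le> l" and fin: "hitting_time w l < \<infinity>"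
  shows "\<bar>w (enn2real (hitting_time w l))\<bar> = l"
proof -
  obtain s where s: "0 \<le> s" "hitting_time w l = ennreal s" "l \<le> \<bar>w s\<bar>"
    using hitting_time_attained[OF cont fin] .
  have "continuous_on {0..s} (\<lambda>u. \<bar>w u\<bar>)"
    by (intro continuous_intros continuous_on_subset[OF cont]) auto
  then obtain u where u: "0 \<le> u" "u \<le> s" "\<bar>w u\<bar> = l"
    using IVT'[of "\<lambda>u. \<bar>w u\<bar>" 0 l s] assms(2) s by auto
  then have "ennreal s \<le> ennreal u"
    using hitting_time_lower[of u l w] s by simp
  with u s show ?thesis by simp
qed

text \<open>
  By continuity, the level \<open>l\<close> is hit by time \<open>t\<close> exactly if the running maximum at \<open>t\<close> is at least \<open>l\<close>,
  and this event is known at time \<open>t\<close>.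
\<close>

lemma stopping_time_hitting_time:
  fixes X :: "real \<Rightarrow> 'a \<Rightarrow> real"
  assumes filt: "filtration \<Omega> \<F>" and "adapted \<F> X"
    and cont: "\<And>\<omega>. \<omega> \<in> \<Omega> \<Longrightarrow> continuous_on {0..} (\<lambda>s. X s \<omega>)" and "0 < l"
  shows "stopping_time \<F> (\<lambda>\<omega>. hitting_time (\<lambda>s. X s \<omega>) l)"
proof
  fix t
  interpret filtration \<Omega> \<F> by fact
  show "Measurable.pred (\<F> t) (\<lambda>\<omega>. hitting_time (\<lambda>s. X s \<omega>) l \<le> t)"
  proof (cases "t = \<infinity>")
    case False
    have [measurable]: "(\<lambda>\<omega>. running_max (\<lambda>s. X s \<omega>) t) \<in> borel_measurable (\<F> t)"
    proof (rule measurable_running_max)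
      fix q :: real assume "0 \<le> q" "\<exists>\<omega>\<in>space (\<F> t). ennreal q \<le> t"
      then have "X q \<in> borel_measurable (\<F> (ennreal q))" "sets (\<F> (ennreal q)) \<subseteq> sets (\<F> t)"
        using \<open>adapted \<F> X\<close> sets_F_mono by (auto simp: adapted_def)
      then show "X q \<in> borel_measurable (\<F> t)"
        by (intro measurable_from_subalg[of "\<F> t" "\<F> (ennreal q)"]) (auto simp: subalgebra_def space_F)
    qed (auto simp: cont space_F)
    have "Measurable.pred (\<F> t) (\<lambda>\<omega>. ennreal l \<le> running_max (\<lambda>s. X s \<omega>) t)" by measurable
    then show ?thesis
      by (rule measurable_cong[THEN iffD1, rotated])
        (use False \<open>0 < l\<close> cont in \<open>auto simp: hitting_time_le_iff space_F less_top\<close>)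
  qed simp
qed

text \<open>
  On the event \<open>T \<le> t\<close>, the complementary relation \<open>S < T\<close> is witnessed by some \<open>r \<le> t\<close> from a
  countable set with \<open>S \<le> r < T\<close>.
\<close>

lemma stopping_time_le_in_pre_sigma:
  fixes S T :: "'a \<Rightarrow> 't::{linorder_topology, second_countable_topology}"
  assumes filt: "filtration \<Omega> \<F>" and T: "stopping_time \<F> T" and S: "stopping_time \<F> S"
  shows "Measurable.pred (filtration.pre_sigma \<Omega> \<F> T) (\<lambda>\<omega>. T \<omega> \<le> S \<omega>)"
proof -
  interpret filtration \<Omega> \<F> by fact
  have "Measurable.pred (pre_sigma T) (\<lambda>\<omega>. S \<omega> < T \<omega>)"
  proof (rule pred_pre_sigmaI[OF T])
    fix t
    obtain D :: "'t set"
      where D: "countable D" "\<And>x y. x < y \<Longrightarrow> (\<exists>b\<in>D. x \<le> b \<and> b < y)"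
      using countable_separating_set_linorder2 by auto
    have "Measurable.pred (\<F> t) (\<lambda>\<omega>. (\<exists>r\<in>{r\<in>D. r \<le> t}. S \<omega> \<le> r \<and> \<not> T \<omega> \<le> r) \<and> T \<omega> \<le> t)"
      by (intro pred_intros_logic measurable_pred_countable countable_Collect D
          stopping_time_le_const T S) auto
    moreover have "(S \<omega> < T \<omega> \<and> T \<omega> \<le> t)
        \<longleftrightarrow> ((\<exists>r\<in>{r\<in>D. r \<le> t}. S \<omega> \<le> r \<and> \<not> T \<omega> \<le> r) \<and> T \<omega> \<le> t)" for \<omega>
      using D(2)[of "S \<omega>" "T \<omega>"] by fastforce
    ultimately show "Measurable.pred (\<F> t) (\<lambda>\<omega>. S \<omega> < T \<omega> \<and> T \<omega> \<le> t)" by simp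
  qed
  then have "Measurable.pred (pre_sigma T) (\<lambda>\<omega>. \<not> S \<omega> < T \<omega>)" by (rule pred_intros_logic)
  then show ?thesis by (simp add: not_less)
qed

section \<open>Tail estimates for the running maximum\<close>

text \<open>
  The strong Markov property in integrated form: the conditional probability of the shifted path lying
  in \<open>A\<close> is bounded by \<open>c\<close> on the event \<open>G\<close>, which is known at time \<open>T\<close>. Measurability of the
  event is proved alongside, as it is needed to compare it with smaller events.
\<close>

lemma prob_shifted_path_le:
  fixes X :: "real \<Rightarrow> 'a \<Rightarrow> real"
  assumes usual: "usual_conditions M \<F>" and "adapted \<F> X"
    and cont: "\<And>\<omega>. \<omega> \<in> space M \<Longrightarrow> continuous_on {0..} (\<lambda>s. X s \<omega>)"
    and markov: "strong_markov P M \<F> X"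
    and T: "stopping_time \<F> T" and A [measurable]: "A \<in> sets path_space"
    and G: "G \<in> sets (filtration.pre_sigma (space M) \<F> T)"
    and c: "AE \<omega> in M. \<omega> \<in> G \<longrightarrow> T \<omega> < \<infinity> \<and> measure (P (X (enn2real (T \<omega>)) \<omega>)) A \<le> c"
  shows "{\<omega>\<in>G. (\<lambda>s. X (enn2real (T \<omega>) + s) \<omega>) \<in> A} \<in> sets M"
    and "measure M {\<omega>\<in>G. (\<lambda>s. X (enn2real (T \<omega>) + s) \<omega>) \<in> A} \<le> c * measure M G"
proof -
  interpret prob_space M using usual by (simp add: usual_conditions_def)
  have filt: "filtration (space M) \<F>" and sub: "\<And>t. subalgebra M (\<F> t)"
    using usual by (auto simp: usual_conditions_def)
  interpret filtration "space M" \<F> by fact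
  have sub_pre: "subalgebra M (pre_sigma T)"
  proof (unfold subalgebra_def, intro conjI subsetI)
    fix E assume E: "E \<in> sets (pre_sigma T)"
    have "{\<omega>\<in>E. T \<omega> \<le> \<infinity>} \<in> sets (\<F> \<infinity>)" by (rule sets_pre_sigmaD[OF T E])
    then show "E \<in> sets M" using sub[of \<infinity>] by (auto simp: subalgebra_def)
  qed (simp add: space_pre_sigma)
  interpret pre: finite_measure_subalgebra M "pre_sigma T"
    by unfold_locales (rule sub_pre)
  have [measurable]: "G \<in> sets M" using G sub_pre by (auto simp: subalgebra_def)
  have [measurable]: "T \<in> borel_measurable M"
    by (rule measurable_from_subalg[OF sub_pre measurable_stopping_time_pre_sigma[OF T]])
  have X_meas: "X s \<in> borel_measurable M" if "0 \<le> s" for s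
    using \<open>adapted \<F> X\<close> that by (auto simp: adapted_def intro: measurable_from_subalg[OF sub])
  have [measurable]: "(\<lambda>\<omega> s. X (enn2real (T \<omega>) + s) \<omega>) \<in> measurable M path_space"
  proof (rule measurable_path_spaceI)
    show "continuous_on {0..} (\<lambda>s. X (enn2real (T \<omega>) + s) \<omega>)" if "\<omega> \<in> space M" for \<omega>
      by (rule continuous_on_compose2[OF cont[OF that]]) (auto intro!: continuous_intros)
    show "(\<lambda>\<omega>. X (enn2real (T \<omega>) + s) \<omega>) \<in> borel_measurable M" if "0 \<le> s" for s
      by (rule measurable_at_random_time[where Y = X]) (use that in \<open>auto intro: X_meas cont\<close>)
  qed
  define f :: "'a \<Rightarrow> real" where "f = (\<lambda>\<omega>. indicator A (\<lambda>s. X (enn2real (T \<omega>) + s) \<omega>))"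
  have [measurable]: "f \<in> borel_measurable M" unfolding f_def by measurable
  have f_int: "integrable M f"
    by (rule integrable_const_bound[where B = 1]) (auto simp: f_def indicator_def)
  have "G \<inter> ((\<lambda>\<omega> s. X (enn2real (T \<omega>) + s) \<omega>) -` A \<inter> space M) \<in> sets M" by measurable
  also have "G \<inter> ((\<lambda>\<omega> s. X (enn2real (T \<omega>) + s) \<omega>) -` A \<inter> space M)
      = {\<omega>\<in>G. (\<lambda>s. X (enn2real (T \<omega>) + s) \<omega>) \<in> A}"
    using sets.sets_into_space[OF \<open>G \<in> sets M\<close>] by auto
  finally show in_M: "{\<omega>\<in>G. (\<lambda>s. X (enn2real (T \<omega>) + s) \<omega>) \<in> A} \<in> sets M" .
  have "measure M {\<omega>\<in>G. (\<lambda>s. X (enn2real (T \<omega>) + s) \<omega>) \<in> A}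
      = (\<integral>\<omega>. indicator {\<omega>\<in>G. (\<lambda>s. X (enn2real (T \<omega>) + s) \<omega>) \<in> A} \<omega> \<partial>M)"
    using in_M by simp
  also have "\<dots> = (\<integral>\<omega>\<in>G. f \<omega> \<partial>M)"
    unfolding set_lebesgue_integral_def
    by (intro Bochner_Integration.integral_cong) (auto simp: f_def indicator_def)
  also have "\<dots> = (\<integral>\<omega>\<in>G. real_cond_exp M (pre_sigma T) f \<omega> \<partial>M)"
    by (rule pre.real_cond_exp_intA[OF f_int G])
  also have "\<dots> \<le> (\<integral>\<omega>\<in>G. c \<partial>M)"
    unfolding set_lebesgue_integral_def
  proof (rule integral_mono_AE)
    show "integrable M (\<lambda>\<omega>. indicator G \<omega> *\<^sub>R real_cond_exp M (pre_sigma T) f \<omega>)"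
      using pre.real_cond_exp_int(1)[OF f_int] by (intro integrable_mult_indicator) auto
    show "integrable M (\<lambda>\<omega>. indicator G \<omega> *\<^sub>R c)"
      by (intro integrable_mult_indicator) auto
    have "AE \<omega> in M. T \<omega> < \<infinity> \<longrightarrow>
        real_cond_exp M (pre_sigma T) f \<omega> = measure (P (X (enn2real (T \<omega>)) \<omega>)) A"
      using markov T A unfolding strong_markov_def f_def by blast
    then show "AE \<omega> in M. indicator G \<omega> *\<^sub>R real_cond_exp M (pre_sigma T) f \<omega> \<le> indicator G \<omega> *\<^sub>R c"
      using c by eventually_elim (auto simp: indicator_def)
  qed
  also have "\<dots> = c * measure M G"
    by (simp add: set_lebesgue_integral_def)
  finally show "measure M {\<omega>\<in>G. (\<lambda>s. X (enn2real (T \<omega>) + s) \<omega>) \<in> A} \<le> c * measure M G" .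
qed

text \<open>
  Let \<open>T\<close> be the first time at which \<open>|X|\<close> reaches \<open>l\<close>. For the running maximum at \<open>\<tau> \<le> t\<close> to reach \<open>\<beta> l\<close>,
  the process must first reach \<open>l\<close>, so \<open>T \<le> \<tau>\<close>, and after \<open>T\<close> it must climb to \<open>\<beta> l\<close> within a further
  time at most \<open>t\<close>. The event \<open>T \<le> \<tau>\<close> is known at time \<open>T\<close>, and \<open>|X\<^sub>T| = l\<close>, so the strong Markov
  property bounds the conditional probability of the climb by \<open>c\<close>.
\<close>

lemma prob_running_max_le_before:
  fixes X :: "real \<Rightarrow> 'a \<Rightarrow> real"
  assumes usual: "usual_conditions M \<F>" and adapted: "adapted \<F> X"
    and cont: "\<And>\<omega>. \<omega> \<in> space M \<Longrightarrow> continuous_on {0..} (\<lambda>s. X s \<omega>)"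
    and start: "AE \<omega> in M. X 0 \<omega> = 0"
    and markov: "strong_markov P M \<F> X"
    and \<tau>: "stopping_time \<F> \<tau>"
    and "0 \<le> t" "0 < l" "1 \<le> \<beta>" "0 \<le> c"
    and c: "\<And>x. \<bar>x\<bar> = l \<Longrightarrow> measure (P x) (paths_reaching t (\<beta> * l)) \<le> c"
  shows "measure M {\<omega>\<in>space M. \<tau> \<omega> \<le> ennreal t \<and> ennreal (\<beta> * l) \<le> running_max (\<lambda>s. X s \<omega>) (\<tau> \<omega>)}
    \<le> c * measure M {\<omega>\<in>space M. ennreal l \<le> running_max (\<lambda>s. X s \<omega>) (\<tau> \<omega>)}"
proof -
  interpret prob_space M using usual by (simp add: usual_conditions_def)
  have filt: "filtration (space M) \<F>" and sub: "\<And>t. subalgebra M (\<F> t)"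
    using usual by (auto simp: usual_conditions_def)
  interpret filtration "space M" \<F> by fact
  define T where "T \<omega> = hitting_time (\<lambda>s. X s \<omega>) l" for \<omega>
  have T: "stopping_time \<F> T"
    unfolding T_def by (rule stopping_time_hitting_time[OF filt adapted cont \<open>0 < l\<close>])
  have meas_stop: "S \<in> borel_measurable M" if "stopping_time \<F> S" for S :: "'a \<Rightarrow> ennreal"
    using that sub by (intro measurable_stopping_time[of \<F> S M]) (auto simp: subalgebra_def)
  have [measurable]: "\<tau> \<in> borel_measurable M" "T \<in> borel_measurable M"
    by (intro meas_stop \<tau> T)+
  have X_meas: "X s \<in> borel_measurable M" if "0 \<le> s" for s
    using adapted that by (auto simp: adapted_def intro: measurable_from_subalg[OF sub])
  have [measurable]: "(\<lambda>\<omega>. running_max (\<lambda>s. X s \<omega>) (\<tau> \<omega>)) \<in> borel_measurable M"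
    by (intro measurable_running_max X_meas cont) auto
  define G where "G = {\<omega>\<in>space M. T \<omega> \<le> \<tau> \<omega> \<and> T \<omega> < \<infinity>}"
  have G: "G \<in> sets (pre_sigma T)"
  proof -
    note [measurable] = stopping_time_le_in_pre_sigma[OF filt T \<tau>] measurable_stopping_time_pre_sigma[OF T]
    have "{\<omega>\<in>space (pre_sigma T). T \<omega> \<le> \<tau> \<omega> \<and> T \<omega> < \<infinity>} \<in> sets (pre_sigma T)" by measurable
    then show ?thesis by (simp add: G_def space_pre_sigma)
  qed
  have G_sub: "G \<subseteq> {\<omega>\<in>space M. ennreal l \<le> running_max (\<lambda>s. X s \<omega>) (\<tau> \<omega>)}"
  proof
    fix \<omega> assume "\<omega> \<in> G"
    then have \<omega>: "\<omega> \<in> space M" "T \<omega> \<le> \<tau> \<omega>" "T \<omega> < \<infinity>" by (auto simp: G_def)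
    have "ennreal l \<le> running_max (\<lambda>s. X s \<omega>) (T \<omega>)"
      using hitting_time_le_iff[OF cont[OF \<omega>(1)] \<omega>(3) \<open>0 < l\<close>] by (simp add: T_def)
    also have "\<dots> \<le> running_max (\<lambda>s. X s \<omega>) (\<tau> \<omega>)" by (rule running_max_mono) fact
    finally show "\<omega> \<in> {\<omega>\<in>space M. ennreal l \<le> running_max (\<lambda>s. X s \<omega>) (\<tau> \<omega>)}"
      using \<omega> by simp
  qed
  let ?Y = "\<lambda>\<omega> s. X (enn2real (T \<omega>) + s) \<omega>"
  have shift: "\<omega> \<in> G \<and> ?Y \<omega> \<in> paths_reaching t (\<beta> * l)"
    if \<omega>: "\<omega> \<in> space M" "\<tau> \<omega> \<le> ennreal t" "ennreal (\<beta> * l) \<le> running_max (\<lambda>s. X s \<omega>) (\<tau> \<omega>)" for \<omega>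
  proof -
    have "\<tau> \<omega> < \<infinity>" using \<omega>(2) by (auto intro: le_less_trans)
    obtain s where s: "0 \<le> s" "ennreal s \<le> \<tau> \<omega>" "running_max (\<lambda>s. X s \<omega>) (\<tau> \<omega>) = ennreal \<bar>X s \<omega>\<bar>"
      using running_max_attained[OF cont[OF \<omega>(1)] \<open>\<tau> \<omega> < \<infinity>\<close>] .
    have le: "\<beta> * l \<le> \<bar>X s \<omega>\<bar>" using \<omega>(3) s(3) by (simp add: ennreal_le_iff)
    have "1 * l \<le> \<beta> * l" using \<open>1 \<le> \<beta>\<close> \<open>0 < l\<close> by (intro mult_right_mono) auto
    with le have "T \<omega> \<le> ennreal s"
      unfolding T_def by (intro hitting_time_lower s) simp
    then obtain r where r: "0 \<le> r" "T \<omega> = ennreal r" "r \<le> s"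
      using s(1) by (cases "T \<omega>") (auto simp: top_unique)
    have "s \<le> t" using s \<omega>(2) \<open>0 \<le> t\<close> by (metis ennreal_le_iff order_trans)
    have "\<omega> \<in> G"
      using \<omega>(1) order_trans[OF \<open>T \<omega> \<le> ennreal s\<close> s(2)] r by (auto simp: G_def)
    moreover have "?Y \<omega> \<in> paths_reaching t (\<beta> * l)"
    proof -
      have "continuous_on {0..} (?Y \<omega>)"
        by (rule continuous_on_compose2[OF cont[OF \<omega>(1)]]) (auto intro!: continuous_intros)
      moreover have "ennreal (\<beta> * l) \<le> running_max (?Y \<omega>) (ennreal t)"
      proof (rule order_trans)
        show "ennreal (\<beta> * l) \<le> ennreal \<bar>?Y \<omega> (s - r)\<bar>"
          using le r by (auto intro: ennreal_leI)
        show "ennreal \<bar>?Y \<omega> (s - r)\<bar> \<le> running_max (?Y \<omega>) (ennreal t)"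
          using r \<open>s \<le> t\<close> by (intro running_max_upper) (auto intro: ennreal_leI)
      qed
      ultimately show ?thesis by (simp add: paths_reaching_def space_path_space)
    qed
    ultimately show ?thesis ..
  qed
  \<comment> \<open>The exceptional null set is where \<open>X\<close> does not start at \<open>0\<close>: such a path may already lie
    above the level \<open>l\<close> at its hitting time \<open>0\<close>.\<close>
  have c_AE: "AE \<omega> in M. \<omega> \<in> G \<longrightarrow>
      T \<omega> < \<infinity> \<and> measure (P (X (enn2real (T \<omega>)) \<omega>)) (paths_reaching t (\<beta> * l)) \<le> c"
    using start AE_space
  proof eventually_elim
    case (elim \<omega>)
    then have "\<bar>X (enn2real (T \<omega>)) \<omega>\<bar> = l" if "T \<omega> < \<infinity>"
      using that \<open>0 < l\<close> unfolding T_def by (intro abs_at_hitting_time cont) auto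
    then show ?case by (auto simp: G_def intro!: c)
  qed
  have in_M: "{\<omega>\<in>G. ?Y \<omega> \<in> paths_reaching t (\<beta> * l)} \<in> sets M"
    by (rule prob_shifted_path_le(1)[OF usual adapted _ markov T sets_paths_reaching G c_AE]) (rule cont)
  have "measure M {\<omega>\<in>space M. \<tau> \<omega> \<le> ennreal t \<and> ennreal (\<beta> * l) \<le> running_max (\<lambda>s. X s \<omega>) (\<tau> \<omega>)}
      \<le> measure M {\<omega>\<in>G. ?Y \<omega> \<in> paths_reaching t (\<beta> * l)}"
    using shift in_M by (intro finite_measure_mono) auto
  also have "\<dots> \<le> c * measure M G"
    by (rule prob_shifted_path_le(2)[OF usual adapted _ markov T sets_paths_reaching G c_AE]) (rule cont)
  also have "\<dots> \<le> c * measure M {\<omega>\<in>space M. ennreal l \<le> running_max (\<lambda>s. X s \<omega>) (\<tau> \<omega>)}"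
    using G_sub \<open>0 \<le> c\<close> by (intro mult_left_mono finite_measure_mono) measurable
  finally show ?thesis .
qed

lemma prob_running_max_moment_bound:
  fixes X :: "real \<Rightarrow> 'a \<Rightarrow> real"
  assumes "finite_measure M"
    and cont: "\<And>\<omega>. \<omega> \<in> space M \<Longrightarrow> continuous_on {0..} (\<lambda>s. X s \<omega>)"
    and X: "\<And>s. 0 \<le> s \<Longrightarrow> X s \<in> borel_measurable M"
    and "0 < p" "0 < a" "0 \<le> B"
    and moment: "(\<integral>\<^sup>+\<omega>. mono_extension (\<lambda>x. x powr p) (running_max (\<lambda>s. X s \<omega>) (ennreal t)) \<partial>M) \<le> ennreal B"
  shows "measure M {\<omega>\<in>space M. ennreal a \<le> running_max (\<lambda>s. X s \<omega>) (ennreal t)} \<le> B / a powr p"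
proof -
  interpret finite_measure M by fact
  define E where "E = {\<omega>\<in>space M. ennreal a \<le> running_max (\<lambda>s. X s \<omega>) (ennreal t)}"
  have [measurable]: "(\<lambda>\<omega>. running_max (\<lambda>s. X s \<omega>) (ennreal t)) \<in> borel_measurable M"
    by (intro measurable_running_max X cont) auto
  have [measurable]: "E \<in> sets M" unfolding E_def by measurable
  have mono: "mono_on {0..} (\<lambda>x. x powr p)"
    using \<open>0 < p\<close> by (auto intro!: mono_onI powr_mono2)
  have "ennreal (a powr p) * emeasure M E = (\<integral>\<^sup>+\<omega>. ennreal (a powr p) * indicator E \<omega> \<partial>M)"
    by (simp add: nn_integral_cmult)
  also have "\<dots> \<le> (\<integral>\<^sup>+\<omega>. mono_extension (\<lambda>x. x powr p) (running_max (\<lambda>s. X s \<omega>) (ennreal t)) \<partial>M)"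
  proof (rule nn_integral_mono)
    fix \<omega>
    show "ennreal (a powr p) * indicator E \<omega>
      \<le> mono_extension (\<lambda>x. x powr p) (running_max (\<lambda>s. X s \<omega>) (ennreal t))"
    proof (cases "\<omega> \<in> E")
      case True
      then have "mono_extension (\<lambda>x. x powr p) (ennreal a)
          \<le> mono_extension (\<lambda>x. x powr p) (running_max (\<lambda>s. X s \<omega>) (ennreal t))"
        by (intro mono_extension_mono mono) (auto simp: E_def)
      with True \<open>0 < a\<close> show ?thesis by simp
    qed simp
  qed
  also note moment
  finally have "ennreal (a powr p * measure M E) \<le> ennreal B"
    by (simp add: emeasure_eq_measure ennreal_mult)
  then have "a powr p * measure M E \<le> B" using \<open>0 \<le> B\<close> by (simp add: ennreal_le_iff)
  then show ?thesis using \<open>0 < a\<close> by (simp add: E_def field_simps)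
qed

section \<open>The moment inequality at stopping times\<close>

theorem theorem2p3:
  fixes b \<sigma> g :: "real \<Rightarrow> real"
    and P :: "real \<Rightarrow> (real \<Rightarrow> real) measure"
    and M :: "'a measure" and \<F> :: "ennreal \<Rightarrow> 'a measure"
    and B X :: "real \<Rightarrow> 'a \<Rightarrow> real"
    and N :: "real \<Rightarrow> 'b measure" and \<G> :: "real \<Rightarrow> ennreal \<Rightarrow> 'b measure"
    and W Y :: "real \<Rightarrow> real \<Rightarrow> 'b \<Rightarrow> real"
    and p C\<^sub>p :: real
  assumes "b \<in> borel_measurable borel"
    and "\<And>x. 0 \<le> \<sigma> x"
    and "\<And>x. \<exists>e>0. bounded (\<sigma> ` ball x e)"
    and "diffusion b \<sigma> P M \<F> B 0 X"
    and "\<And>x. diffusion b \<sigma> P (N x) (\<G> x) (W x) x (Y x)"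
    and "continuous_on {0..} g" and "strict_mono_on {0..} g" and "g 0 = 0"
    and "controllable P"
    and "p > 0" and "C\<^sub>p > 0"
    and "\<And>t. t \<ge> 0 \<Longrightarrow>
      (\<integral>\<^sup>+\<omega>. mono_extension (\<lambda>x. x powr p) (running_max (\<lambda>s. X s \<omega>) (ennreal t)) \<partial>M)
        \<le> ennreal (C\<^sub>p * g t powr p)"
  shows "\<forall>F. moderate F \<longrightarrow> (\<exists>C\<^sub>F>0. \<forall>\<tau>. stopping_time \<F> \<tau> \<longrightarrow>
      (\<integral>\<^sup>+\<omega>. mono_extension F (running_max (\<lambda>s. X s \<omega>) (\<tau> \<omega>)) \<partial>M)
        \<le> ennreal C\<^sub>F * (\<integral>\<^sup>+\<omega>. mono_extension F (mono_extension g (\<tau> \<omega>)) \<partial>M))"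
proof (intro allI impI)
  fix F assume F: "moderate F"
  note g = assms(6-8) and moment = assms(12)
  have sol: "weak_solution b \<sigma> M \<F> B 0 X" and law: "distr M path_space (\<lambda>\<omega> t. X t \<omega>) = P 0"
    and markov: "strong_markov P M \<F> X"
    using assms(4) by (auto simp: diffusion_def)
  have usual: "usual_conditions M \<F>" and adapted: "adapted \<F> X"
    and cont: "\<And>\<omega>. \<omega> \<in> space M \<Longrightarrow> continuous_on {0..} (\<lambda>s. X s \<omega>)"
    and start: "AE \<omega> in M. X 0 \<omega> = 0"
    using sol by (auto simp: weak_solution_def)
  interpret prob_space M using usual by (simp add: usual_conditions_def)
  have sub: "\<And>t. subalgebra M (\<F> t)" using usual by (auto simp: usual_conditions_def)
  have X_meas: "X s \<in> borel_measurable M" if "0 \<le> s" for s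
    using adapted that by (auto simp: adapted_def intro: measurable_from_subalg[OF sub])
  have X_path [measurable]: "(\<lambda>\<omega> s. X s \<omega>) \<in> measurable M path_space"
    by (intro measurable_path_spaceI cont X_meas)
  have prob_P: "prob_space (P x)" for x
    using markov measurable_space[of P borel "prob_algebra path_space" x]
    by (simp add: strong_markov_def space_prob_algebra)
  have g_mono: "mono_on {0..} g" using g(2) by (rule strict_mono_on_imp_mono_on)
  have g_nonneg: "0 \<le> g t" if "0 \<le> t" for t
    using mono_onD[OF g_mono, of 0 t] that g(3) by simp

  obtain \<gamma> C \<beta> where "0 < \<gamma>" "0 < C" "1 < \<beta>" and control: "\<And>t l. 0 \<le> t \<Longrightarrow> 0 < l \<Longrightarrow>
      (SUP x\<in>{x. \<bar>x\<bar> = l}. measure (P x) (paths_reaching t (\<beta> * l))) \<le> C * measure (P 0) (paths_reaching t (\<gamma> * l))"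
    using assms(9) unfolding controllable_def paths_reaching_def by blast

  \<comment> \<open>Controllability compares the exit probability from the level \<open>l\<close> with one for the process
    started at \<open>0\<close>, to which Markov's inequality and the moment hypothesis apply. The bound is
    uniform in \<open>l\<close> and tends to \<open>0\<close> with \<open>\<delta>\<close>.\<close>
  have exit_bound: "measure (P x) (paths_reaching t (\<beta> * l)) \<le> C * C\<^sub>p * (\<delta> / \<gamma>) powr p"
    if "\<bar>x\<bar> = l" "0 < l" "0 \<le> t" "0 < \<delta>" "g t \<le> \<delta> * l" for x t l \<delta>
  proof -
    have "measure (P x) (paths_reaching t (\<beta> * l)) \<le> (SUP x\<in>{x. \<bar>x\<bar> = l}. measure (P x) (paths_reaching t (\<beta> * l)))"
      using that prob_space.prob_le_1[OF prob_P] by (intro cSUP_upper bdd_aboveI[of _ 1]) auto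
    also have "\<dots> \<le> C * measure (P 0) (paths_reaching t (\<gamma> * l))" using that by (intro control)
    also have "measure (P 0) (paths_reaching t (\<gamma> * l))
        = measure M {\<omega>\<in>space M. ennreal (\<gamma> * l) \<le> running_max (\<lambda>s. X s \<omega>) (ennreal t)}"
      unfolding law[symmetric] using cont
      by (subst measure_distr[OF X_path sets_paths_reaching])
        (auto simp: paths_reaching_def space_path_space intro!: arg_cong[where f = "measure M"])
    also have "\<dots> \<le> C\<^sub>p * g t powr p / (\<gamma> * l) powr p"
      using that \<open>0 < \<gamma>\<close> assms(10,11)
      by (intro prob_running_max_moment_bound cont X_meas moment) (auto intro: finite_measure_axioms)
    also have "\<dots> \<le> C\<^sub>p * (\<delta> * l) powr p / (\<gamma> * l) powr p"
      using that \<open>0 < \<gamma>\<close> assms(10,11) g_nonneg[of t]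
      by (intro divide_right_mono mult_left_mono powr_mono2) auto
    also have "\<dots> = C\<^sub>p * (\<delta> / \<gamma>) powr p"
      using that \<open>0 < \<gamma>\<close> by (simp add: powr_mult powr_divide)
    finally show ?thesis using \<open>0 < C\<close> by (simp add: mult.assoc)
  qed

  obtain K where K: "1 \<le> K" "\<And>x. mono_extension F (ennreal \<beta> * x) \<le> ennreal K * mono_extension F x"
    using moderate_dilation[OF F, of \<beta>] by blast
  \<comment> \<open>\<open>\<delta>\<close> solves \<open>\<epsilon> K = 1/2\<close>, which is what the absorption in the good-\<open>\<lambda>\<close> argument allows. Its value does
    not depend on the stopping time, and so neither does the final constant.\<close>
  define \<delta> where "\<delta> = \<gamma> * (1 / (2 * C * C\<^sub>p * K)) powr (1 / p)"
  have "0 < 1 / (2 * C * C\<^sub>p * K)" using \<open>0 < C\<close> assms(11) K(1) by simp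
  then have "0 < (1 / (2 * C * C\<^sub>p * K)) powr (1 / p)" by (rule powr_gt_zero[THEN iffD2, OF less_imp_neq[THEN not_sym]])
  then have "0 < \<delta>" unfolding \<delta>_def using \<open>0 < \<gamma>\<close> by (rule mult_pos_pos[rotated])
  define \<epsilon> where "\<epsilon> = C * C\<^sub>p * (\<delta> / \<gamma>) powr p"
  have "0 \<le> \<epsilon>" using \<open>0 < C\<close> assms(11) by (simp add: \<epsilon>_def)
  have "\<epsilon> * K = 1 / 2"
  proof -
    have "(\<delta> / \<gamma>) powr p = 1 / (2 * C * C\<^sub>p * K)"
      using \<open>0 < \<gamma>\<close> assms(10) \<open>0 < 1 / (2 * C * C\<^sub>p * K)\<close> by (simp add: \<delta>_def powr_powr)
    then show ?thesis using \<open>0 < C\<close> assms(11) K(1) by (simp add: \<epsilon>_def)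
  qed
  obtain L where L: "1 \<le> L" "\<And>x. mono_extension F (ennreal (1 / \<delta>) * x) \<le> ennreal L * mono_extension F x"
    using moderate_dilation[OF F, of "1 / \<delta>"] by blast

  show "\<exists>C\<^sub>F>0. \<forall>\<tau>. stopping_time \<F> \<tau> \<longrightarrow>
      (\<integral>\<^sup>+\<omega>. mono_extension F (running_max (\<lambda>s. X s \<omega>) (\<tau> \<omega>)) \<partial>M)
        \<le> ennreal C\<^sub>F * (\<integral>\<^sup>+\<omega>. mono_extension F (mono_extension g (\<tau> \<omega>)) \<partial>M)"
  proof (intro exI[of _ "2 * K * L"] conjI allI impI)
    show "0 < 2 * K * L" using K L by simp
    fix \<tau> assume \<tau>: "stopping_time \<F> \<tau>"
    \<comment> \<open>Localisation: replacing \<open>\<tau>\<close> by \<open>min \<tau> n\<close> makes every time finite, and capping the maximum at \<open>n\<close>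
      makes it bounded. The constant does not depend on \<open>n\<close>, which tends to \<open>\<infinity>\<close> at the end.\<close>
    define R where "R n \<omega> = running_max (\<lambda>s. X s \<omega>) (min (\<tau> \<omega>) (of_nat n))" for n \<omega>
    define Q where "Q n \<omega> = min (R n \<omega>) (of_nat n)" for n \<omega>
    define Z where "Z n \<omega> = mono_extension g (min (\<tau> \<omega>) (of_nat n))" for n \<omega>
    have \<tau>_n: "stopping_time \<F> (\<lambda>\<omega>. min (\<tau> \<omega>) (of_nat n))" for n
      by (intro stopping_time_min stopping_time_const \<tau>)
    have [measurable]: "\<tau> \<in> borel_measurable M"
      using \<tau> sub by (intro measurable_stopping_time[of \<F> \<tau> M]) (auto simp: subalgebra_def)
    have R_meas [measurable]: "R n \<in> borel_measurable M" for n
      unfolding R_def by (intro measurable_running_max X_meas cont) auto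
    have Q_meas [measurable]: "Q n \<in> borel_measurable M" for n
      unfolding Q_def by measurable
    have Z_meas [measurable]: "Z n \<in> borel_measurable M" for n
      unfolding Z_def by (intro measurable_mono_extension g g_mono) measurable

    have tail: "measure M {\<omega>\<in>space M. ennreal (\<beta> * l) \<le> Q n \<omega> \<and> ennreal (1 / \<delta>) * Z n \<omega> < ennreal l}
        \<le> \<epsilon> * measure M {\<omega>\<in>space M. ennreal l \<le> Q n \<omega>}" if "0 < l" for l n
    proof (cases "\<beta> * l \<le> real n")
      case False
      \<comment> \<open>Above the cap the left-hand event is empty.\<close>
      then have empty: "{\<omega>\<in>space M. ennreal (\<beta> * l) \<le> Q n \<omega> \<and> ennreal (1 / \<delta>) * Z n \<omega> < ennreal l} = {}"
        by (auto simp: Q_def ennreal_of_nat_eq_real_of_nat ennreal_le_iff)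
      show ?thesis unfolding empty using \<open>0 \<le> \<epsilon>\<close> by simp
    next
      case True
      \<comment> \<open>A deterministic time that bounds \<open>min \<tau> n\<close> whenever \<open>g\<close> of it is below \<open>\<delta> l\<close>. If
        \<open>g(n) \<le> \<delta> l\<close>, then \<open>n\<close> itself serves; otherwise it is a solution of \<open>g t = \<delta> l\<close>.\<close>
      obtain t where t: "0 \<le> t" "g t \<le> \<delta> * l"
        and before: "\<And>s. 0 \<le> s \<Longrightarrow> s \<le> real n \<Longrightarrow> g s < \<delta> * l \<Longrightarrow> s \<le> t"
      proof (cases "g (real n) \<le> \<delta> * l")
        case True
        with that show thesis by (metis of_nat_0_le_iff)
      next
        case False
        then obtain t where "0 \<le> t" "g t = \<delta> * l"
          using IVT'[of g 0 "\<delta> * l" "real n"] g(3) \<open>0 < \<delta>\<close> \<open>0 < l\<close>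
            continuous_on_subset[OF g(1), of "{0..real n}"] by auto
        moreover have "s \<le> t" if "0 \<le> s" "g s < g t" for s
          using that \<open>0 \<le> t\<close> mono_onD[OF g_mono, of t s] by (metis atLeast_iff leI le_less_trans less_irrefl less_imp_le)
        ultimately show thesis using that by (metis order_refl)
      qed
      have "1 * l \<le> \<beta> * l" using \<open>1 < \<beta>\<close> \<open>0 < l\<close> by (intro mult_right_mono) auto
      have "measure M {\<omega>\<in>space M. ennreal (\<beta> * l) \<le> Q n \<omega> \<and> ennreal (1 / \<delta>) * Z n \<omega> < ennreal l}
        \<le> measure M {\<omega>\<in>space M. min (\<tau> \<omega>) (of_nat n) \<le> ennreal t \<and> ennreal (\<beta> * l) \<le> R n \<omega>}"
      proof (rule finite_measure_mono, safe)
        fix \<omega> assume \<omega>: "\<omega> \<in> space M" "ennreal (\<beta> * l) \<le> Q n \<omega>" "ennreal (1 / \<delta>) * Z n \<omega> < ennreal l"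
        show "ennreal (\<beta> * l) \<le> R n \<omega>" using \<omega>(2) by (simp add: Q_def)
        obtain s where s: "0 \<le> s" "min (\<tau> \<omega>) (of_nat n) = ennreal s"
          by (cases "min (\<tau> \<omega>) (of_nat n)") (auto simp: min_def top_unique split: if_splits)
        then have "ennreal s \<le> of_nat n" by (metis min.cobounded2)
        then have "s \<le> real n" by (simp add: ennreal_of_nat_eq_real_of_nat ennreal_le_iff)
        have "ennreal (1 / \<delta>) * Z n \<omega> = ennreal (1 / \<delta> * g s)"
          unfolding Z_def s(2) mono_extension_ennreal[OF s(1)]
          using g_nonneg[OF s(1)] \<open>0 < \<delta>\<close> by (intro ennreal_mult[symmetric]) auto
        with \<omega>(3) have "1 / \<delta> * g s < l"
          using g_nonneg[of s] s \<open>0 < \<delta>\<close> by (simp add: ennreal_less_iff)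
        then have "g s < \<delta> * l" using \<open>0 < \<delta>\<close> by (simp add: field_simps)
        then show "min (\<tau> \<omega>) (of_nat n) \<le> ennreal t"
          using before s \<open>s \<le> real n\<close> by (auto intro: ennreal_leI)
      qed measurable
      also have "\<dots> \<le> \<epsilon> * measure M {\<omega>\<in>space M. ennreal l \<le> R n \<omega>}"
        unfolding R_def
      proof (rule prob_running_max_le_before[OF usual adapted _ start markov \<tau>_n])
        show "measure (P x) (paths_reaching t (\<beta> * l)) \<le> \<epsilon>" if "\<bar>x\<bar> = l" for x
          unfolding \<epsilon>_def using that \<open>0 < l\<close> t \<open>0 < \<delta>\<close> by (intro exit_bound)
      qed (use t \<open>0 < l\<close> \<open>1 < \<beta>\<close> \<open>0 \<le> \<epsilon>\<close> cont in auto)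
      also have "{\<omega>\<in>space M. ennreal l \<le> R n \<omega>} = {\<omega>\<in>space M. ennreal l \<le> Q n \<omega>}"
        using True \<open>1 * l \<le> \<beta> * l\<close>
        by (auto simp: Q_def ennreal_of_nat_eq_real_of_nat intro!: ennreal_leI)
      finally show ?thesis .
    qed
    have bound: "(\<integral>\<^sup>+\<omega>. mono_extension F (Q n \<omega>) \<partial>M)
        \<le> ennreal (2 * K * L) * (\<integral>\<^sup>+\<omega>. mono_extension F (mono_extension g (\<tau> \<omega>)) \<partial>M)" for n
    proof -
      have "(\<integral>\<^sup>+\<omega>. mono_extension F (Q n \<omega>) \<partial>M) \<le> ennreal (2 * K * L) * (\<integral>\<^sup>+\<omega>. mono_extension F (Z n \<omega>) \<partial>M)"
      proof (rule good_lambda_bounded[OF finite_measure_axioms moderateD[OF F] Q_meas Z_meas _ _ K(2) L(2) tail])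
        show "Q n \<omega> \<le> ennreal (real n)" for \<omega>
          by (simp add: Q_def ennreal_of_nat_eq_real_of_nat)
      qed (use \<open>1 < \<beta>\<close> \<open>0 \<le> \<epsilon>\<close> \<open>\<epsilon> * K = 1 / 2\<close> K L in auto)
      also have "\<dots> \<le> ennreal (2 * K * L) * (\<integral>\<^sup>+\<omega>. mono_extension F (mono_extension g (\<tau> \<omega>)) \<partial>M)"
        unfolding Z_def
        by (intro mult_left_mono nn_integral_mono mono_extension_mono moderateD(2)[OF F] g_mono) auto
      finally show ?thesis .
    qed
    have inc: "incseq (\<lambda>n. Q n \<omega>)" for \<omega>
      unfolding Q_def R_def
      by (intro monoI min.mono running_max_mono) (auto simp: of_nat_le_iff)
    have SUP_Q: "running_max (\<lambda>s. X s \<omega>) (\<tau> \<omega>) = (SUP n. Q n \<omega>)" for \<omega>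
    proof -
      have SUP_R: "running_max (\<lambda>s. X s \<omega>) (\<tau> \<omega>) = (SUP n. R n \<omega>)"
        unfolding R_def by (rule running_max_SUP_min)
      have R_mono: "R m \<omega> \<le> R n \<omega>" if "m \<le> n" for m n
        unfolding R_def using that by (intro running_max_mono min.mono) auto
      show ?thesis
        unfolding SUP_R
      proof (rule antisym)
        show "(SUP n. R n \<omega>) \<le> (SUP n. Q n \<omega>)"
        proof (rule dense_le)
          fix y assume "y < (SUP n. R n \<omega>)"
          then obtain n where n: "y < R n \<omega>" by (auto simp: less_SUP_iff)
          then have "y < top" by (auto intro: less_le_trans)
          then obtain m :: nat where "y < of_nat m"
            using less_SUP_iff[of y of_nat "UNIV :: nat set"] by (auto simp: ennreal_SUP_of_nat_eq_top)
          then have "y < Q (max m n) \<omega>"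
            using n R_mono[of n "max m n"] by (auto simp: Q_def intro: less_le_trans)
          then show "y \<le> (SUP n. Q n \<omega>)" by (intro SUP_upper2[of "max m n"]) auto
        qed
        show "(SUP n. Q n \<omega>) \<le> (SUP n. R n \<omega>)"
          by (intro SUP_mono) (auto simp: Q_def intro: min.cobounded1)
      qed
    qed
    have "(\<integral>\<^sup>+\<omega>. mono_extension F (running_max (\<lambda>s. X s \<omega>) (\<tau> \<omega>)) \<partial>M)
        = (\<integral>\<^sup>+\<omega>. (SUP n. mono_extension F (Q n \<omega>)) \<partial>M)"
      by (simp add: SUP_Q mono_extension_SUP[OF moderateD[OF F] inc])
    also have "\<dots> = (SUP n. \<integral>\<^sup>+\<omega>. mono_extension F (Q n \<omega>) \<partial>M)"
    proof (rule nn_integral_monotone_convergence_SUP)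
      show "incseq (\<lambda>n \<omega>. mono_extension F (Q n \<omega>))"
        using inc by (auto simp: incseq_def le_fun_def intro!: mono_extension_mono moderateD(2)[OF F])
      show "(\<lambda>\<omega>. mono_extension F (Q n \<omega>)) \<in> borel_measurable M" for n
        by (intro measurable_mono_extension moderateD[OF F] Q_meas)
    qed
    also have "\<dots> \<le> ennreal (2 * K * L) * (\<integral>\<^sup>+\<omega>. mono_extension F (mono_extension g (\<tau> \<omega>)) \<partial>M)"
      by (intro SUP_least bound)
    finally show "(\<integral>\<^sup>+\<omega>. mono_extension F (running_max (\<lambda>s. X s \<omega>) (\<tau> \<omega>)) \<partial>M)
        \<le> ennreal (2 * K * L) * (\<integral>\<^sup>+\<omega>. mono_extension F (mono_extension g (\<tau> \<omega>)) \<partial>M)" .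
  qed
qed

end
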